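(* Let $S$ be an $\mathbb{F}_3$-linear set of rank $5$ in $\mathrm{PG}(1,3^5)$ with $|S|>1$. Then either: (a) $S$ contains one point of weight $4$ and $81$ of weight $1$ (and hence is a $4$-club), or (b) $S$ contains one point of weight $3$, and $0$, $3$ or $9$ points of weight $2$, and all others of weight $1$, or (c) $S$ contains $s$ points of weight $2$, where $s\in\{2,3,4,5,6,7,8,10\}$, and all others of weight $1$, or (d) $S$ contains $121$ points of weight $1$ (and hence is scattered). The possible sizes for an $\mathbb{F}_3$-linear set of rank $5$ in $\mathrm{PG}(1,3^5)$ (with more than one point) are $82,91,97,100,103,106,109,112,115$ and $121$, and all these possibilities occur.
   Context: Let $q$ be a prime power. A set $S$ of points of $\mathrm{PG}(1,q^5)=\mathrm{PG}(\mathbb{F}_{q^5}^2)$ is an $\mathbb{F}_q$-linear set of rank $k$ if $S=L_U=\{\langle v\rangle_{q^5} : v\in U\setminus\{0\}\}$ for some $k$-dimensional $\mathbb{F}_q$-subspace $U$ of $\mathbb{F}_{q^5}^2$, where $\langle v\rangle_{q^5}$ is the projective point spanned by $v$. The weight of a point $P=\langle v\rangle_{q^5}$ of $L_U$ is the $\mathbb{F}_q$-dimension of $U\cap\langle v\rangle_{q^5}$. (For linear sets of rank $5$ in $\mathrm{PG}(1,q^5)$ the weight does not depend on the choice of $U$ with $S=L_U$.) A linear set of rank $k$ is scattered if it has precisely $\frac{q^k-1}{q-1}$ points, equivalently all of its points have weight $1$. A $k_0$-club is an $\mathbb{F}_q$-linear set of rank $k$ having one point of weight $k_0$ and all its other points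 of weight $1$. *)

theory Defs
  imports "HOL-Analysis.Analysis"
begin

(* The extension F_(q^5)/F_q (in general: 'a over 'k) is given by its structure map
   \<phi> from the small field 'k to the large field 'a; injectivity is automatic. *)

locale field_embedding =
  fixes \<phi> :: "'k::field \<Rightarrow> 'a::field"
  assumes add: "\<phi> (x + y) = \<phi> x + \<phi> y"
    and mult: "\<phi> (x * y) = \<phi> x * \<phi> y"
    and one: "\<phi> 1 = 1"

(* The ambient plane is 'a ^ 2.  Its 'a-linear structure is the library's vec.* (scalar
   multiplication *s); its 'k-linear structure is obtained by restricting scalars along \<phi>. *)

definition small_scale :: "('k::field \<Rightarrow> 'a::field) \<Rightarrow> 'k \<Rightarrow> 'a ^ 2 \<Rightarrow> 'a ^ 2" where
  "small_scale \<phi> c v = \<phi> c *s v"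

lemma vector_space_small_scale:
  assumes "field_embedding \<phi>"
  shows "vector_space (small_scale \<phi>)"
proof -
  interpret field_embedding \<phi> by fact
  show ?thesis
    by unfold_locales
      (simp_all add: small_scale_def add mult one vec.scale_right_distrib vec.scale_left_distrib)
qed

abbreviation small_subspace :: "('k::field \<Rightarrow> 'a::field) \<Rightarrow> ('a ^ 2) set \<Rightarrow> bool" where
  "small_subspace \<phi> \<equiv> module.subspace (small_scale \<phi>)"

abbreviation small_dim :: "('k::field \<Rightarrow> 'a::field) \<Rightarrow> ('a ^ 2) set \<Rightarrow> nat" where
  "small_dim \<phi> \<equiv> vector_space.dim (small_scale \<phi>)"

(* Points of PG(1, 'a) are the one-dimensional 'a-subspaces of 'a ^ 2, as sets of vectors. *)

definition proj_point :: "'a::field ^ 2 \<Rightarrow> ('a ^ 2) set" where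
  "proj_point v = vec.span {v}"

definition L :: "('a::field ^ 2) set \<Rightarrow> ('a ^ 2) set set" where
  "L U = {proj_point v | v. v \<in> U - {0}}"

definition linear_set :: "('k::field \<Rightarrow> 'a::field) \<Rightarrow> nat \<Rightarrow> ('a ^ 2) set set \<Rightarrow> bool" where
  "linear_set \<phi> k S \<longleftrightarrow> (\<exists>U. small_subspace \<phi> U \<and> small_dim \<phi> U = k \<and> S = L U)"

(* In general the weight depends on the subspace U defining the linear set,
   not only on L U; hence U is an explicit argument here and in club. *)

definition weight :: "('k::field \<Rightarrow> 'a::field) \<Rightarrow> ('a ^ 2) set \<Rightarrow> ('a ^ 2) set \<Rightarrow> nat" where
  "weight \<phi> U P = small_dim \<phi> (U \<inter> P)"

definition points_of_weight ::
    "('k::field \<Rightarrow> 'a::field) \<Rightarrow> ('a ^ 2) set \<Rightarrow> nat \<Rightarrow> ('a ^ 2) set set" where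
  "points_of_weight \<phi> U i = {P \<in> L U. weight \<phi> U P = i}"

definition scattered :: "('k::field \<Rightarrow> 'a::field) \<Rightarrow> nat \<Rightarrow> ('a ^ 2) set set \<Rightarrow> bool" where
  "scattered \<phi> k S \<longleftrightarrow>
     linear_set \<phi> k S \<and> card S = (CARD('k) ^ k - 1) div (CARD('k) - 1)"

definition club :: "('k::field \<Rightarrow> 'a::field) \<Rightarrow> nat \<Rightarrow> ('a ^ 2) set \<Rightarrow> bool" where
  "club \<phi> k0 U \<longleftrightarrow> small_subspace \<phi> U \<and>
     (\<exists>P \<in> L U. weight \<phi> U P = k0 \<and> (\<forall>Q \<in> L U - {P}. weight \<phi> U Q = 1))"

end

theory Submission
  imports Defs
begin

text \<open>
  Choose a basis \<open>v0\<close>, \<open>v1\<close> of the plane over \<open>F = GF(243)\<close>. A subspace \<open>U\<close> of rank 5 becomes an additive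
  group \<open>X\<close> of 243 pairs \<open>(x, y)\<close>, the vectors of \<open>U\<close> being \<open>x v0 + y v1\<close>. The point spanned by
  \<open>m v0 + v1\<close> meets \<open>U\<close> in a copy of the slice \<open>{y. (m y, y) \<in> X}\<close>, and the point spanned by \<open>v0\<close> in a copy
  of \<open>{x. (x, 0) \<in> X}\<close>. Counting the nonzero vectors of \<open>U\<close> point by point gives
  \<open>n1 + 4 n2 + 13 n3 + 40 n4 = 121\<close> for the numbers of points of each weight (\<open>weight_equations\<close>), and two
  points have weights of sum at most 5 (\<open>weight_add_le\<close>). So a point of weight 4 forces all the others
  to have weight 1, a point of weight 3 is unique, and everything depends on \<open>n2\<close>.

  If \<open>P\<close> has weight 3 and some \<open>Q\<close> has weight 2, the basis can be chosen on \<open>P\<close> and \<open>Q\<close> with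
  \<open>X = A \<times> B\<close>, where \<open>A\<close> has 27 elements and \<open>B\<close> is generated by 1 and some \<open>b\<close> outside \<open>GF(3)\<close>. Then \<open>n2\<close>
  is the order of \<open>{m \<in> A. b m \<in> A}\<close>. This is a power of 3; it exceeds 1 because \<open>27 * 27 > 243\<close>, and it is
  less than 27 because multiplication by \<open>b\<close> leaves no proper nonzero subgroup of \<open>F\<close> invariant
  (\<open>stable_subgrp\<close>).

  If all weights are at most 2 and \<open>v0\<close> spans a point of weight 2, then \<open>X\<close> is brought to one of
  \<open>2 * 13 * 81\<close> normal forms (\<open>normal_form\<close>). Scaling turns \<open>{x. (x, 0) \<in> X}\<close> into the group generated by 1
  and \<open>a\<close>, and another choice of its two generators is a Moebius map applied to \<open>a\<close>; the 48 irreducible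
  quintics over \<open>GF(3)\<close> form two orbits under these maps, so \<open>a\<close> may be taken to be a root of one of two
  fixed quintics. The projection of \<open>X\<close> to the second coordinate has 27 elements, hence contains some
  \<open>z \<noteq> 0\<close> together with \<open>a z\<close>; after scaling it is generated by \<open>1, a, c\<close> with 13 possibilities for \<open>c\<close>, and
  shears leave 81 possibilities for the rest of \<open>X\<close>. In a normal form the slice at \<open>m\<close> has nine elements
  exactly when three vectors of \<open>GF(3)^3\<close> computed from \<open>m\<close> span a line (\<open>card_slice_normal_set\<close>). Evaluating
  this condition for all normal forms other than the 26 that contain a point of weight 3 gives the
  possible values of \<open>n2\<close>, and a few of them are examples for eight of the sizes. The remaining two sizes are
  those of the scattered set given by the pairs \<open>(x^3, x)\<close> and of the 4-club given by \<open>H \<times> GF(3)\<close> with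
  \<open>H\<close> of order 81.
\<close>

section \<open>The field with three elements\<close>

text \<open>A concrete copy of the prime field, with constructors for 0, 1 and -1, so that statements about
  tuples over it can be decided by rewriting.\<close>

datatype gf3 = Zr | Po | Ne

instantiation gf3 :: enum
begin
definition "enum_gf3 = [Zr, Po, Ne]"
definition "enum_all_gf3 P \<longleftrightarrow> P Zr \<and> P Po \<and> P Ne"
definition "enum_ex_gf3 P \<longleftrightarrow> P Zr \<or> P Po \<or> P Ne"
instance
proof
  show "(UNIV :: gf3 set) = set enum_class.enum"
    using gf3.exhaust by (auto simp: enum_gf3_def)
  fix P :: "gf3 \<Rightarrow> bool"
  show "enum_class.enum_all P \<longleftrightarrow> Ball UNIV P"
    by (auto simp: enum_all_gf3_def) (metis gf3.exhaust)
  show "enum_class.enum_ex P \<longleftrightarrow> Bex UNIV P"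
    by (auto simp: enum_ex_gf3_def) (metis gf3.exhaust)
qed (simp add: enum_gf3_def)
end

instantiation gf3 :: comm_ring_1
begin
definition "zero_gf3 = Zr"
definition "one_gf3 = Po"
fun uminus_gf3 where "- Zr = Zr" | "- Po = Ne" | "- Ne = Po"
fun plus_gf3 where
  "Zr + y = y" | "Po + Zr = Po" | "Po + Po = Ne" | "Po + Ne = Zr"
| "Ne + Zr = Ne" | "Ne + Po = Zr" | "Ne + Ne = Po"
fun times_gf3 where "Zr * (y::gf3) = Zr" | "Po * y = y" | "Ne * y = - y"
definition "minus_gf3 (x::gf3) y = x + - y"
instance
proof
  fix x y z :: gf3
  show "x + y + z = x + (y + z)" by (cases x; cases y; cases z) simp_all
  show "x * y * z = x * (y * z)" by (cases x; cases y; cases z) simp_all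
  show "(x + y) * z = x * z + y * z" by (cases x; cases y; cases z) simp_all
  show "x + y = y + x" by (cases x; cases y) simp_all
  show "x * y = y * x" by (cases x; cases y) simp_all
  show "0 + x = x" "1 * x = x" by (cases x; simp add: zero_gf3_def one_gf3_def)+
  show "- x + x = 0" by (cases x) (simp_all add: zero_gf3_def)
  show "x - y = x + - y" by (simp add: minus_gf3_def)
  show "(0::gf3) \<noteq> 1" by (simp add: zero_gf3_def one_gf3_def)
qed
end

lemma gf3_UNIV: "(UNIV :: gf3 set) = {0, 1, -1}"
  using gf3.exhaust by (auto simp: zero_gf3_def one_gf3_def)

lemma card_gf3: "CARD(gf3) = 3"
  by (simp add: gf3_UNIV) (simp add: zero_gf3_def one_gf3_def)

primrec of3 :: "gf3 \<Rightarrow> 'a::ring_1" where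
  "of3 Zr = 0" | "of3 Po = 1" | "of3 Ne = - 1"

lemma of3_01 [simp]: "of3 0 = 0" "of3 1 = 1" "of3 (- x) = - of3 x"
  by (simp_all add: zero_gf3_def one_gf3_def) (cases x; simp)

lemma of3_times [simp]: "of3 (x * y) = of3 x * of3 y"
  by (cases x; cases y) simp_all

section \<open>Additive groups of exponent three\<close>

definition subgrp :: "'b::ab_group_add set \<Rightarrow> bool" where
  "subgrp H \<longleftrightarrow> 0 \<in> H \<and> (\<forall>x\<in>H. \<forall>y\<in>H. x + y \<in> H) \<and> (\<forall>x\<in>H. - x \<in> H)"

lemma subgrpD:
  assumes "subgrp H"
  shows "0 \<in> H" "\<And>x y. x \<in> H \<Longrightarrow> y \<in> H \<Longrightarrow> x + y \<in> H" "\<And>x. x \<in> H \<Longrightarrow> - x \<in> H"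
    "\<And>x y. x \<in> H \<Longrightarrow> y \<in> H \<Longrightarrow> x - y \<in> H"
proof -
  show *: "0 \<in> H" "\<And>x y. x \<in> H \<Longrightarrow> y \<in> H \<Longrightarrow> x + y \<in> H" "\<And>x. x \<in> H \<Longrightarrow> - x \<in> H"
    using assms by (auto simp: subgrp_def)
  show "\<And>x y. x \<in> H \<Longrightarrow> y \<in> H \<Longrightarrow> x - y \<in> H" 
    using *(2,3) by (metis diff_conv_add_uminus)
qed

lemma subgrp_image:
  fixes f :: "'b::ab_group_add \<Rightarrow> 'c::ab_group_add"
  assumes f: "\<And>x y. f (x + y) = f x + f y" and H: "subgrp H"
  shows "subgrp (f ` H)"
proof -
  have 0: "f 0 = 0" using f[of 0 0] by simp
  have neg: "- f x = f (- x)" for x using f[of "- x" x] 0 by (simp add: neg_eq_iff_add_eq_0 add.commute)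
  have "- f x \<in> f ` H" if "x \<in> H" for x unfolding neg by (rule imageI) (rule subgrpD(3)[OF H that])
  moreover have "f x + f y \<in> f ` H" if "x \<in> H" "y \<in> H" for x y
    unfolding f[symmetric] by (rule imageI) (rule subgrpD(2)[OF H that])
  moreover have "0 \<in> f ` H" using 0 subgrpD(1)[OF H] by (metis imageI)
  ultimately show ?thesis unfolding subgrp_def by blast
qed

lemma subgrp_range:
  fixes f :: "'b::ab_group_add \<Rightarrow> 'c::ab_group_add"
  assumes "\<And>x y. f (x + y) = f x + f y"
  shows "subgrp (range f)"
  by (rule subgrp_image[OF assms]) (simp add: subgrp_def)

lemma subgrp_Int: "subgrp G \<Longrightarrow> subgrp H \<Longrightarrow> subgrp (G \<inter> H)"
  by (auto simp: subgrp_def)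

definition extend :: "'b::ab_group_add set \<Rightarrow> 'b \<Rightarrow> 'b set" where
  "extend H x = H \<union> (+) x ` H \<union> (+) (- x) ` H"

lemma
  fixes x :: "'b::ab_group_add"
  assumes H: "subgrp H" "finite H" "x \<notin> H" and three: "\<And>z::'b. z + z + z = 0"
  shows subgrp_extend: "subgrp (extend H x)"
    and card_extend: "card (extend H x) = 3 * card H"
proof -
  note h = subgrpD[OF H(1)]
  have xx: "x + x = - x" using three[of x] by (simp add: eq_neg_iff_add_eq_0)
  have E: "z \<in> extend H x \<longleftrightarrow> (\<exists>i\<in>{0, x, - x}. \<exists>u\<in>H. z = i + u)" for z
    unfolding extend_def by force
  show "subgrp (extend H x)"
    unfolding subgrp_def
  proof (intro conjI ballI)
    show "0 \<in> extend H x" using h(1) E by force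
    fix u assume "u \<in> extend H x"
    then obtain i u' where u: "u = i + u'" "i \<in> {0, x, -x}" "u' \<in> H" unfolding E by blast
    have "- u = - i + - u'" "- i \<in> {0, x, - x}" using u by auto
    then show "- u \<in> extend H x" using E h(3)[OF u(3)] by blast
    fix v assume "v \<in> extend H x"
    then obtain j v' where v: "v = j + v'" "j \<in> {0, x, -x}" "v' \<in> H" unfolding E by blast
    have "- x + - x = x" using xx by (metis minus_add_distrib add.inverse_inverse)
    then have "i + j \<in> {0, x, -x}" using u(2) v(2) xx by auto
    moreover have "u + v = (i + j) + (u' + v')" using u v by (simp add: algebra_simps)
    ultimately show "u + v \<in> extend H x" using E h(2)[OF u(3) v(3)] by blast
  qed
  have shift: "s \<in> H" if "u \<in> H" "u = s + v" "v \<in> H" for s u v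
    using that h(4)[of u v] by simp
  have d1: "H \<inter> (+) x ` H = {}" using H(3) shift by blast
  have d2: "H \<inter> (+) (- x) ` H = {}" using H(3) shift h(3)[of "- x"] by auto
  have d3: "(+) x ` H \<inter> (+) (- x) ` H = {}"
  proof (rule ccontr)
    assume "\<not> ?thesis"
    then obtain g k where "g \<in> H" "k \<in> H" "x + g = - x + k" by auto
    then have "x + x = k - g" by (simp add: algebra_simps)
    then have "- x \<in> H" using xx h(4)[OF \<open>k \<in> H\<close> \<open>g \<in> H\<close>] by simp
    then show False using H(3) h(3) by force
  qed
  have c: "card ((+) x ` H) = card H" "card ((+) (- x) ` H) = card H" by (simp_all add: card_image)
  have "card (extend H x) = card (H \<union> (+) x ` H) + card ((+) (- x) ` H)"
    unfolding extend_def using d2 d3 H(2) by (intro card_Un_disjoint) auto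
  also have "card (H \<union> (+) x ` H) = card H + card ((+) x ` H)"
    using d1 H(2) by (intro card_Un_disjoint) auto
  finally show "card (extend H x) = 3 * card H" using c by simp
qed

lemma extend_subset: "subgrp G \<Longrightarrow> H \<subseteq> G \<Longrightarrow> x \<in> G \<Longrightarrow> extend H x \<subseteq> G"
  unfolding extend_def subgrp_def by blast

text \<open>A subgroup that is largest among those of order a power of three is the whole group, since
  adjoining a further element would triple its order.\<close>

lemma card_subgrp_power:
  fixes G :: "'b::ab_group_add set"
  assumes G: "subgrp G" "finite G" and three: "\<And>z::'b. z + z + z = 0"
  shows "\<exists>n. card G = 3 ^ n"
proof -
  define P where "P = (\<lambda>H. subgrp H \<and> H \<subseteq> G \<and> (\<exists>n. card H = 3 ^ n))"
  have "P {0}" using G by (auto simp: P_def subgrp_def intro: exI[of _ 0])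
  moreover have "\<forall>H. P H \<longrightarrow> card H \<le> card G"
    using G by (auto simp: P_def card_mono)
  ultimately obtain H where H: "P H" "\<And>K. P K \<Longrightarrow> card K \<le> card H"
    using ex_has_greatest_nat[of P "{0}" card "Suc (card G)"] less_Suc_eq_le by metis
  have "H = G"
  proof (rule ccontr)
    assume "H \<noteq> G"
    then obtain x where x: "x \<in> G" "x \<notin> H" using H(1) P_def by auto
    have fH: "finite H" using H(1) G(2) finite_subset by (auto simp: P_def)
    have sH: "subgrp H" "H \<subseteq> G" using H(1) by (auto simp: P_def)
    obtain n where n: "card H = 3 ^ n" using H(1) P_def by auto
    have c: "card (extend H x) = 3 * card H" by (rule card_extend[OF sH(1) fH x(2) three])
    have "P (extend H x)" unfolding P_def
      using subgrp_extend[OF sH(1) fH x(2) three] extend_subset[OF G(1) sH(2) x(1)] c n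
      by (metis power_Suc)
    then have "3 * card H \<le> card H" using H(2) c by metis
    then show False using n by simp
  qed
  then show ?thesis using H(1) P_def by auto
qed

text \<open>The sums \<open>g + h\<close> are pairwise distinct. This bounds the weights of two points from above, and
  its contrapositive is the pigeonhole principle that produces a nonzero common element.\<close>

lemma card_subgrp_product_le:
  assumes "subgrp G" "subgrp H" "G \<inter> H = {0}" "finite T" "\<And>g h. g \<in> G \<Longrightarrow> h \<in> H \<Longrightarrow> g + h \<in> T"
  shows "card G * card H \<le> card T"
proof -
  have "inj_on (\<lambda>(g,h). g + h) (G \<times> H)"
  proof (rule inj_onI, clarify)
    fix g h g' h' assume *: "g \<in> G" "h \<in> H" "g' \<in> G" "h' \<in> H" "g + h = g' + h'"
    have "g - g' \<in> G" using * subgrpD(4)[OF assms(1)] by simp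
    moreover have "g - g' = h' - h" using *(5) by (simp add: algebra_simps)
    then have "g - g' \<in> H" using * subgrpD(4)[OF assms(2)] by simp
    ultimately have "g - g' = 0" using assms(3) by blast
    then show "g = g' \<and> h = h'" using *(5) by simp
  qed
  then have "card (G \<times> H) \<le> card T"
    by (rule card_inj_on_le) (use assms in auto)
  then show ?thesis by (simp add: card_cartesian_product)
qed

section \<open>The field with 243 elements\<close>

text \<open>The type argument only fixes \<open>'a\<close>. Characteristic three is a consequence of the order, below.\<close>

locale gf243 =
  fixes field_type :: "'a::field itself"
  assumes card_field: "CARD('a) = 3 ^ 5"
begin

lemma finite_field [simp]: "finite (UNIV :: 'a set)" "finite (S :: 'a set)"
proof -
  show "finite (UNIV :: 'a set)" using card_field by (metis card.infinite power_eq_0_iff zero_neq_numeral)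
  then show "finite S" by (rule rev_finite_subset) simp
qed

lemma three: "(3 :: 'a) = 0"
proof -
  \<comment> \<open>Translation by 1 permutes the field, so 243 times 1 vanishes.\<close>
  have "(\<Sum>x\<in>UNIV. x + 1) = (\<Sum>x\<in>UNIV. x :: 'a)"
    by (rule sum.reindex_bij_witness[of _ "\<lambda>x. x - 1" "\<lambda>x. x + 1"]) auto
  then have "of_nat (CARD('a)) = (0 :: 'a)" by (simp add: sum.distrib)
  then have "(3::'a) ^ 5 = 0" by (simp add: card_field)
  then show ?thesis by (metis power_eq_0_iff)
qed

lemma triple: "z + z + z = (0 :: 'a)"
proof -
  have "z + z + z = 3 * z" by simp
  then show ?thesis using three by simp
qed

lemma two: "(2 :: 'a) = - 1" "(1 + 1 :: 'a) = - 1"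
  using three by (simp_all add: eq_neg_iff_add_eq_0)

lemma of3_plus [simp]: "(of3 (x + y) :: 'a) = of3 x + of3 y"
  using two by (cases x; cases y) (simp_all)

lemma of3_minus [simp]: "(of3 (x - y) :: 'a) = of3 x - of3 y"
  by (metis diff_conv_add_uminus of3_plus of3_01(3))

lemma one_neq_minus_one: "(1 :: 'a) \<noteq> - 1"
  using two by (metis add.inverse_inverse add_cancel_right_left one_neq_zero)

lemma of3_inject [simp]: "(of3 x :: 'a) = of3 y \<longleftrightarrow> x = y"
  using one_neq_minus_one by (cases x; cases y) (auto dest: sym)

lemma of3_eq_0 [simp]: "(of3 x :: 'a) = 0 \<longleftrightarrow> x = 0"
  by (metis of3_inject of3_01(1))

text \<open>Multiplication by \<open>a\<close> permutes \<open>S\<close>, so the product of the elements of \<open>S\<close> absorbs the factor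
  \<open>a ^ card S\<close>.\<close>

lemma power_card_stable:
  assumes "(0::'a) \<notin> S" "(*) a ` S \<subseteq> S" "a \<noteq> 0"
  shows "a ^ card S = 1"
proof -
  have inj: "inj_on ((*) a) S" using assms(3) by (auto simp: inj_on_def)
  have "(*) a ` S = S" using endo_inj_surj[OF _ assms(2) inj] by simp
  then have "prod id S = prod id ((*) a ` S)" by simp
  also have "\<dots> = (\<Prod>x\<in>S. a * x)" by (simp add: prod.reindex[OF inj])
  also have "\<dots> = a ^ card S * prod id S" by (simp add: prod.distrib)
  finally show ?thesis using assms(1) by (simp add: prod_zero_iff)
qed

lemma power_242: assumes "(a::'a) \<noteq> 0" shows "a ^ 242 = 1"
proof -
  have "a ^ card (UNIV - {0::'a}) = 1" by (rule power_card_stable) (use assms in auto)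
  then show ?thesis by (simp add: card_field)
qed

text \<open>The form in which the primality of the degree 5 is used. An invariant subgroup of order \<open>3 ^ n\<close>
  gives \<open>a ^ (3 ^ n - 1) = 1\<close>; since \<open>3 ^ n - 1\<close> and 242 have greatest common divisor 2 for
  \<open>1 \<le> n \<le> 4\<close>, it follows that \<open>a ^ 2 = 1\<close>.\<close>

lemma stable_subgrp:
  assumes "subgrp S" "(*) a ` S \<subseteq> S" "S \<noteq> {0}" "S \<noteq> (UNIV :: 'a set)"
  shows "a \<in> range of3"
proof (cases "a = 0")
  case True then show ?thesis by (metis of3.simps(1) rangeI)
next
  case False
  have "0 \<in> S" using assms by (simp add: subgrp_def)
  obtain n where n: "card S = 3 ^ n" using card_subgrp_power[OF assms(1) _ triple] by auto
  have "card S < 3 ^ 5" using psubset_card_mono[of UNIV S] assms(4) card_field by auto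
  then have "n < 5" using n by (metis nat_power_less_imp_less zero_less_numeral)
  moreover have "card S \<noteq> 1" using assms(3) \<open>0 \<in> S\<close> by (auto simp: card_1_singleton_iff)
  then have "n \<noteq> 0" using n by auto
  ultimately have "n \<in> {1,2,3,4}" by auto
  moreover have e: "a ^ (3 ^ n - 1) = 1"
  proof -
    have "a ^ card (S - {0}) = 1"
      by (rule power_card_stable) (use assms False in auto)
    then show ?thesis using n \<open>0 \<in> S\<close> by simp
  qed
  ultimately have "a ^ 2 = 1 \<or> a ^ 8 = 1 \<or> a ^ 26 = 1 \<or> a ^ 80 = 1" by auto
  then have "a ^ 2 = 1"
  proof (elim disjE)
    assume "a ^ 8 = 1"
    moreover have "a ^ 242 = (a ^ 8) ^ 30 * a ^ 2" by (simp flip: power_mult power_add)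
    ultimately show ?thesis using power_242[OF False] by simp
  next
    assume *: "a ^ 26 = 1"
    moreover have "a ^ 242 = (a ^ 26) ^ 9 * a ^ 8" by (simp flip: power_mult power_add)
    ultimately have "a ^ 8 = 1" using power_242[OF False] by simp
    moreover have "a ^ 26 = (a ^ 8) ^ 3 * a ^ 2" by (simp flip: power_mult power_add)
    ultimately show ?thesis using * by simp
  next
    assume "a ^ 80 = 1"
    moreover have "a ^ 242 = (a ^ 80) ^ 3 * a ^ 2" by (simp flip: power_mult power_add)
    ultimately show ?thesis using power_242[OF False] by simp
  qed
  then have "a = 1 \<or> a = - 1" by (simp add: power2_eq_1_iff)
  then show ?thesis by (metis of3.simps(2,3) rangeI)
qed

end

section \<open>Coordinates with respect to a generator, and quintics up to Moebius maps\<close>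

text \<open>A quintuple holds the coordinates of a field element with respect to \<open>1, a, a^2, a^3, a^4\<close>. If \<open>p\<close>
  holds those of \<open>a ^ 5\<close>, then \<open>shift p\<close> is multiplication by \<open>a\<close> and \<open>mul p\<close> is the product of two
  elements, expanded by the Horner scheme.\<close>

type_synonym q3 = "gf3 \<times> gf3 \<times> gf3"
type_synonym q5 = "gf3 \<times> gf3 \<times> gf3 \<times> gf3 \<times> gf3"

fun scl :: "gf3 \<Rightarrow> q5 \<Rightarrow> q5" where
  "scl s (x0,x1,x2,x3,x4) = (s * x0, s * x1, s * x2, s * x3, s * x4)"

fun shift :: "q5 \<Rightarrow> q5 \<Rightarrow> q5" where
  "shift (p0,p1,p2,p3,p4) (x0,x1,x2,x3,x4) =
     (p0 * x4, x0 + p1 * x4, x1 + p2 * x4, x2 + p3 * x4, x3 + p4 * x4)"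

fun mul :: "q5 \<Rightarrow> q5 \<Rightarrow> q5 \<Rightarrow> q5" where
  "mul p (x0,x1,x2,x3,x4) y =
     scl x0 y + shift p (scl x1 y + shift p (scl x2 y + shift p (scl x3 y + shift p (scl x4 y))))"

fun ev :: "'a \<Rightarrow> q5 \<Rightarrow> 'a::comm_ring_1" where
  "ev a (x0,x1,x2,x3,x4) = of3 x0 + of3 x1 * a + of3 x2 * a^2 + of3 x3 * a^3 + of3 x4 * a^4"

definition par :: "q3 \<Rightarrow> q3 \<Rightarrow> bool" where
  "par k v \<longleftrightarrow> v = 0 \<or> v = k \<or> v = - k"

text \<open>A quintuple \<open>q\<close> also stands for the monic quintic \<open>x^5 - q(x)\<close>.\<close>

fun rooted :: "q5 \<Rightarrow> gf3 \<Rightarrow> bool" where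
  "rooted (q0,q1,q2,q3,q4) t \<longleftrightarrow> t^5 = q0 + q1 * t + q2 * t^2 + q3 * t^3 + q4 * t^4"

text \<open>Division of \<open>x^5 - q(x)\<close> by \<open>x^2 - u x - v\<close> has the quotient \<open>x^3 + g2 x^2 + g1 x + g0\<close>; the two
  equations say that the remainder is zero.\<close>

fun quadratic_factor :: "q5 \<Rightarrow> gf3 \<times> gf3 \<Rightarrow> bool" where
  "quadratic_factor (q0,q1,q2,q3,q4) (u,v) \<longleftrightarrow>
     (let g2 = u - q4; g1 = v - q3 + u * g2; g0 = v * g2 + u * g1 - q2
      in v * g1 + u * g0 = q1 \<and> v * g0 = q0)"

text \<open>The tuple \<open>(s, r, u, t)\<close> stands for the map taking \<open>b\<close> to \<open>(s b + r) / (u b + t)\<close>. Each of the 24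
  elements of \<open>PGL(2, 3)\<close> occurs once; those with \<open>u = 1\<close> are written as \<open>s + r / (b + t)\<close> with \<open>r \<noteq> 0\<close>.\<close>

definition moebius_maps :: "(gf3 \<times> gf3 \<times> gf3 \<times> gf3) list" where
  "moebius_maps = [(s, r, 0, 1). s \<leftarrow> [1, - 1], r \<leftarrow> [0, 1, - 1]] @
     [(s, r + s * t, 1, t). r \<leftarrow> [1, - 1], s \<leftarrow> [0, 1, - 1], t \<leftarrow> [0, 1, - 1]]"

text \<open>Representatives \<open>x^5 - x - 1\<close> and \<open>x^5 - x^4 - x - 1\<close> of the two orbits of \<open>PGL(2, 3)\<close> on the 48
  monic irreducible quintics.\<close>

definition quintics :: "q5 list" where
  "quintics = [(1,1,0,0,0), (1,1,0,0,1)]"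

text \<open>The condition that \<open>n / d\<close> is a root of one of the two quintics, multiplied by \<open>d ^ 5\<close> to avoid
  division in the quotient ring of polynomials modulo \<open>x^5 - q(x)\<close>.\<close>

definition maps_into_quintics where
 "maps_into_quintics q n d =
   (let n2 = mul q n n; n4 = mul q n2 n2; d2 = mul q d d; d4 = mul q d2 d2;
        r = mul q n n4 - mul q d d4 - mul q n d4
    in r = 0 \<or> r = mul q d n4)"

fun moebius_ok :: "q5 \<Rightarrow> gf3 \<times> gf3 \<times> gf3 \<times> gf3 \<Rightarrow> bool" where
  "moebius_ok q (s, r, u, t) \<longleftrightarrow> maps_into_quintics q (r,s,0,0,0) (t,u,0,0,0)"

definition quintic_classified :: "q5 \<Rightarrow> bool" where
  "quintic_classified q \<longleftrightarrow> list_ex (rooted q) enum_class.enum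
     \<or> list_ex (quadratic_factor q) enum_class.enum
     \<or> list_ex (moebius_ok q) moebius_maps"

text \<open>An evaluation over all 243 monic quintics: each is reducible with a factor of degree at most two, or
  a Moebius map takes it to one of the two representatives.\<close>

lemma all_classified: "list_all quintic_classified enum_class.enum"
  by code_simp

context gf243
begin

lemma ev_plus [simp]: "ev (a::'a) (x + y) = ev a x + ev a y"
  by (cases x; cases y) (simp add: algebra_simps)

lemma ev_uminus [simp]: "ev (a::'a) (- x) = - ev a x"
  by (cases x) (simp add: algebra_simps)

lemma ev_minus [simp]: "ev (a::'a) (x - y) = ev a x - ev a y"
  by (cases x; cases y) (simp add: algebra_simps)

lemma ev_0 [simp]: "ev (a::'a) 0 = 0"
  by (simp add: zero_prod_def)

lemma ev_scl [simp]: "ev (a::'a) (scl s x) = of3 s * ev a x"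
  by (cases x) (simp add: algebra_simps)

lemma ev_shift [simp]:
  assumes "a ^ 5 = ev (a::'a) p"
  shows "ev a (shift p x) = a * ev a x"
proof -
  obtain p0 p1 p2 p3 p4 where p: "p = (p0,p1,p2,p3,p4)" by (cases p)
  obtain x0 x1 x2 x3 x4 where x: "x = (x0,x1,x2,x3,x4)" by (cases x)
  have "a * ev a x = of3 x0 * a + of3 x1 * a^2 + of3 x2 * a^3 + of3 x3 * a^4 + of3 x4 * a^5"
    unfolding x by (simp add: algebra_simps power2_eq_square power3_eq_cube power_numeral_reduce)
  then show ?thesis unfolding assms p x by (simp add: algebra_simps)
qed

lemma ev_mul [simp]:
  assumes "a ^ 5 = ev (a::'a) p"
  shows "ev a (mul p x y) = ev a x * ev a y"
proof -
  obtain x0 x1 x2 x3 x4 where x: "x = (x0,x1,x2,x3,x4)" by (cases x)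
  show ?thesis unfolding x
    by (simp add: ev_shift[OF assms] del: ev.simps) 
       (simp add: algebra_simps power2_eq_square power3_eq_cube power_numeral_reduce)
qed

lemma subgrp_range_ev: "subgrp (range (ev (a::'a)))"
  by (rule subgrp_range) (rule ev_plus)

text \<open>The groups generated by \<open>1, ..., a^(j-1)\<close> triple in order as \<open>j\<close> grows up to 5: if \<open>a ^ j\<close> were already
  in one of them, that group would be invariant under multiplication by \<open>a\<close>.\<close>

lemma bij_ev:
  assumes "(a::'a) \<notin> range of3"
  shows "bij (ev a)"
proof -
  define H where "H = rec_nat {0} (\<lambda>j S. extend S (a ^ j))"
  have H: "H 0 = {0}" "\<And>j. H (Suc j) = extend (H j) (a ^ j)" by (simp_all add: H_def)
  have one: "1 \<in> H (Suc j)" for j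
    by (induction j) (simp_all add: H extend_def)
  have step: "(*) a ` H j \<subseteq> H (Suc j)" for j
  proof (induction j)
    case (Suc j)
    have "(*) a ` H (Suc j) = extend ((*) a ` H j) (a ^ Suc j)"
      by (simp add: H extend_def image_Un image_image algebra_simps)
    also have "\<dots> \<subseteq> extend (H (Suc j)) (a ^ Suc j)"
      using Suc by (auto simp: extend_def)
    finally show ?case by (simp add: H)
  qed (simp add: H extend_def)
  have new: "a ^ j \<notin> H j \<and> subgrp (H j) \<and> card (H j) = 3 ^ j" if "j < 5" for j
    using that
  proof (induction j)
    case 0
    then show ?case by (simp add: H subgrp_def)
  next
    case (Suc j)
    then have IH: "a ^ j \<notin> H j" "subgrp (H j)" "card (H j) = 3 ^ j" by auto
    have s: "subgrp (H (Suc j))" unfolding H by (rule subgrp_extend[OF IH(2) _ IH(1) triple]) simp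
    have c: "card (H (Suc j)) = 3 ^ Suc j"
      unfolding H using card_extend[OF IH(2) _ IH(1) triple] IH(3) by simp
    have "a ^ Suc j \<notin> H (Suc j)"
    proof
      assume "a ^ Suc j \<in> H (Suc j)"
      then have "H (Suc (Suc j)) \<subseteq> H (Suc j)"
        unfolding H(2)[of "Suc j"] by (intro extend_subset[OF s]) auto
      then have "(*) a ` H (Suc j) \<subseteq> H (Suc j)" using step by blast
      moreover have "H (Suc j) \<noteq> {0}" using one[of j] by (metis singletonD zero_neq_one)
      moreover have "(3::nat) ^ Suc j < 3 ^ 5" using Suc.prems by (intro power_strict_increasing) auto
      then have "H (Suc j) \<noteq> UNIV" using c card_field by (metis less_irrefl)
      ultimately show False using stable_subgrp[OF s] assms by blast
    qed
    then show ?case using s c by simp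
  qed
  have "card (H 5) = 3 ^ 5"
    using new[of 4] card_extend[of "H 4" "a ^ 4", OF _ _ _ triple] H(2)[of 4] by (simp add: eval_nat_numeral)
  then have "H 5 = UNIV" using card_field by (intro card_eq_UNIV_imp_eq_UNIV) simp_all
  moreover have "a ^ j \<in> range (ev a)" if "j < 5" for j
  proof -
    have "j \<in> {0,1,2,3,4}" using that by auto
    then have "a ^ j \<in> ev a ` {(1,0,0,0,0),(0,1,0,0,0),(0,0,1,0,0),(0,0,0,1,0),(0,0,0,0,1)}"
      by auto
    then show ?thesis by blast
  qed
  then have "H j \<subseteq> range (ev a)" if "j \<le> 5" for j
    using that
  proof (induction j)
    case 0
    then show ?case using subgrpD(1)[OF subgrp_range_ev] by (auto simp: H)
  next
    case (Suc j)
    then show ?case unfolding H by (intro extend_subset[OF subgrp_range_ev]) auto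
  qed
  ultimately have "surj (ev a)" by blast
  moreover have "card (UNIV :: q5 set) = card (range (ev a))"
    using \<open>surj (ev a)\<close> by (simp add: card_field card_gf3)
  then have "inj (ev a)" by (intro eq_card_imp_inj_on) simp_all
  ultimately show ?thesis by (simp add: bij_def)
qed

lemma ev_inject:
  assumes "(a::'a) \<notin> range of3"
  shows "ev a x = ev a y \<longleftrightarrow> x = y"
  using bij_ev[OF assms] by (metis bij_def inj_eq)

lemma ev_eq_0:
  assumes "(a::'a) \<notin> range of3"
  shows "ev a x = 0 \<longleftrightarrow> x = 0"
  using ev_inject[OF assms, of x 0] by (simp)

lemma of3_power [simp]: "of3 (x ^ n) = (of3 x :: 'a) ^ n"
  by (induction n) simp_all

text \<open>A factor of degree one or two would make \<open>a\<close> a zero of a nonzero polynomial of degree at most four,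
  which the independence of \<open>1, a, a^2, a^3, a^4\<close> forbids.\<close>

lemma not_rooted:
  assumes a: "(a::'a) \<notin> range of3" and p: "a ^ 5 = ev a p"
  shows "\<not> rooted p t"
proof
  assume r: "rooted p t"
  obtain p0 p1 p2 p3 p4 where P: "p = (p0,p1,p2,p3,p4)" by (cases p)
  define T where "T = (of3 t :: 'a)"
  have "of3 (t^5) = (of3 (p0 + p1 * t + p2 * t^2 + p3 * t^3 + p4 * t^4) :: 'a)"
    using r P by simp
  then have T5: "T ^ 5 = of3 p0 + of3 p1 * T + of3 p2 * T^2 + of3 p3 * T^3 + of3 p4 * T^4"
    by (simp add: T_def)
  \<comment> \<open>The quotient of \<open>x^5 - p(x)\<close> by \<open>x - t\<close>.\<close>
  define g where "g = (t^4 - p4*t^3 - p3*t^2 - p2*t - p1, t^3 - p4*t^2 - p3*t - p2, t^2-p4*t-p3, t-p4, 1::gf3)"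
  have "(a - T) * ev a g = (a ^ 5 - T^5) - ((of3 p1 * a + of3 p2 * a^2 + of3 p3 * a^3 + of3 p4 * a^4) - (of3 p1 * T + of3 p2 * T^2 + of3 p3 * T^3 + of3 p4 * T^4))"
    unfolding g_def by (simp flip: T_def) (simp add: algebra_simps power2_eq_square power3_eq_cube power_numeral_reduce)
  also have "\<dots> = 0" unfolding T5 p P by simp
  finally have "a = T \<or> ev a g = 0" by simp
  then show False using a ev_eq_0[OF a, of g] by (auto simp: T_def g_def zero_prod_def)
qed

lemma not_quadratic_factor:
  assumes a: "(a::'a) \<notin> range of3" and p: "a ^ 5 = ev a p"
  shows "\<not> quadratic_factor p (u, v)"
proof
  assume r: "quadratic_factor p (u, v)"
  obtain p0 p1 p2 p3 p4 where P: "p = (p0,p1,p2,p3,p4)" by (cases p)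
  define g2 where "g2 = u - p4" 
  define g1 where "g1 = v - p3 + u * g2"
  define g0 where "g0 = v * g2 + u * g1 - p2"
  have e: "p4 = u - g2" "p3 = v + u * g2 - g1" "p2 = v * g2 + u * g1 - g0" 
    "p1 = v * g1 + u * g0" "p0 = v * g0"
    using r by (auto simp: P g2_def g1_def g0_def Let_def)
  have "0 = a ^ 5 - ev a p" using p by simp
  also have "\<dots> = ev a (- v, - u, 1, 0, 0) * ev a (g0, g1, g2, 1, 0)"
    unfolding P e by (simp add: algebra_simps power2_eq_square power3_eq_cube power_numeral_reduce)
  finally have "ev a (- v, - u, 1, 0, 0) = 0 \<or> ev a (g0, g1, g2, 1, 0) = 0"
    by (metis mult_eq_0_iff)
  then show False unfolding ev_eq_0[OF a] by (simp add: zero_prod_def)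
qed

lemma quintics_no_root:
  assumes "(a :: 'a) ^ 5 = ev a p" "p \<in> set quintics"
  shows "a \<notin> range of3"
proof
  assume "a \<in> range of3"
  then obtain t where t: "a = of3 t" by blast
  have "(2::'a) \<noteq> 1" unfolding two(1) using one_neq_minus_one by metis
  moreover have "a ^ 5 = 1 + a \<or> a ^ 5 = 1 + a + a ^ 4" using assms by (auto simp: quintics_def)
  ultimately show False using t one_neq_minus_one by (cases t) (auto simp: three)
qed

text \<open>If \<open>a = (s b + r) / (u b + t)\<close>, then \<open>u b + t\<close> times the group generated by 1 and \<open>a\<close> is the group
  generated by 1 and \<open>b\<close>. Hence this normalises groups of order nine up to scaling.\<close>

lemma quintic_normal_form:
  assumes b: "(b::'a) \<notin> range of3"
  obtains s r u t a p where "ev b (t,u,0,0,0) \<noteq> 0" "a = ev b (r,s,0,0,0) / ev b (t,u,0,0,0)"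
    "a \<notin> range of3" "p \<in> set quintics" "a ^ 5 = ev a p"
proof -
  obtain q where q: "b ^ 5 = ev b q" using bij_ev[OF b] by (metis bij_pointE)
  have "quintic_classified q" using all_classified by (metis UNIV_I enum_UNIV list_all_iff)
  then obtain s r u t where M: "(s,r,u,t) \<in> set moebius_maps" "moebius_ok q (s,r,u,t)"
    using not_rooted[OF b q] not_quadratic_factor[OF b q]
    by (fastforce simp: quintic_classified_def list_ex_iff)
  define n d where "n = ev b (r,s,0,0,0)" and "d = ev b (t,u,0,0,0)"
  have tu: "(t, u) \<noteq> 0"
    using M(1) by (auto simp: moebius_maps_def zero_prod_def)
  have d: "d \<noteq> 0" unfolding d_def using ev_eq_0[OF b] tu by (simp add: zero_prod_def del: ev.simps)
  note m = ev_mul[OF q]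
  define N D where "N = (r,s,0::gf3,0::gf3,0::gf3)" and "D = (t,u,0::gf3,0::gf3,0::gf3)"
  have "n ^ 5 - d ^ 5 - n * d ^ 4 = 0 \<or> n ^ 5 - d ^ 5 - n * d ^ 4 = d * n ^ 4"
  proof -
    have *: "n = ev b N" "d = ev b D" by (simp_all add: n_def d_def N_def D_def)
    have "maps_into_quintics q N D" using M(2) by (simp add: N_def D_def)
    then have "mul q N (mul q (mul q N N) (mul q N N)) - mul q D (mul q (mul q D D) (mul q D D))
        - mul q N (mul q (mul q D D) (mul q D D)) \<in> {0, mul q D (mul q (mul q N N) (mul q N N))}"
      by (simp only: maps_into_quintics_def Let_def insert_iff empty_iff simp_thms)
    from imageI[OF this, of "ev b"] have "ev b (mul q N (mul q (mul q N N) (mul q N N))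
        - mul q D (mul q (mul q D D) (mul q D D)) - mul q N (mul q (mul q D D) (mul q D D)))
      \<in> {ev b 0, ev b (mul q D (mul q (mul q N N) (mul q N N)))}"
      by (simp only: image_insert image_empty)
    then show ?thesis
      unfolding * m ev_minus ev_0 by (simp add: algebra_simps power2_eq_square power_numeral_reduce del: ev.simps)
  qed
  then have "(n/d) ^ 5 = 1 + n/d \<or> (n/d) ^ 5 = 1 + n/d + (n/d) ^ 4"
    using d by (simp add: field_simps power2_eq_square power_numeral_reduce)
  then have "\<exists>p \<in> set quintics. (n/d) ^ 5 = ev (n/d) p"
    unfolding quintics_def by auto
  then obtain p where "p \<in> set quintics" "(n/d) ^ 5 = ev (n/d) p" by blast
  then show ?thesis using that[of t u "n/d" r s p] d quintics_no_root unfolding n_def d_def by blast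
qed

end

section \<open>Additive groups of pairs and their slices\<close>

text \<open>With respect to a basis \<open>v0\<close>, \<open>v1\<close> of the plane, \<open>slice X m\<close> describes the intersection of a subspace
  with the point spanned by \<open>m v0 + v1\<close>, and \<open>slice_inf X\<close> the one with the point spanned by \<open>v0\<close>.\<close>

definition slice :: "('a::field \<times> 'a) set \<Rightarrow> 'a \<Rightarrow> 'a set" where
  "slice X m = {y. (m * y, y) \<in> X}"

definition slice_inf :: "('a::field \<times> 'a) set \<Rightarrow> 'a set" where
  "slice_inf X = {x. (x, 0) \<in> X}"

text \<open>Coordinate changes that fix the point spanned by \<open>v0\<close>. They permute the other points, taking \<open>m\<close> to
  \<open>(\<alpha> m + l) / \<delta>\<close>, and so preserve the distribution of the orders of slices.\<close>

fun triangular :: "'a::field \<Rightarrow> 'a \<Rightarrow> 'a \<Rightarrow> 'a \<times> 'a \<Rightarrow> 'a \<times> 'a" where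
  "triangular \<alpha> l \<delta> (x, y) = (\<alpha> * x + l * y, \<delta> * y)"

definition triangular_equiv :: "('a::field \<times> 'a) set \<Rightarrow> ('a \<times> 'a) set \<Rightarrow> bool" where
  "triangular_equiv X Y \<longleftrightarrow> (\<exists>\<alpha> l \<delta>. \<alpha> \<noteq> 0 \<and> \<delta> \<noteq> 0 \<and> Y = triangular \<alpha> l \<delta> ` X)"

lemma triangular_equivI: "\<alpha> \<noteq> 0 \<Longrightarrow> \<delta> \<noteq> 0 \<Longrightarrow> triangular_equiv X (triangular \<alpha> l \<delta> ` X)"
  unfolding triangular_equiv_def by blast

lemma triangular_equiv_trans:
  assumes "triangular_equiv X Y" "triangular_equiv Y Z"
  shows "triangular_equiv X Z"
proof -
  obtain \<alpha> l \<delta> where 1: "\<alpha> \<noteq> 0" "\<delta> \<noteq> 0" "Y = triangular \<alpha> l \<delta> ` X" using assms triangular_equiv_def by metis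
  obtain \<alpha>' l' \<delta>' where 2: "\<alpha>' \<noteq> 0" "\<delta>' \<noteq> 0" "Z = triangular \<alpha>' l' \<delta>' ` Y" using assms triangular_equiv_def by metis
  have "triangular \<alpha>' l' \<delta>' (triangular \<alpha> l \<delta> v) = triangular (\<alpha>' * \<alpha>) (\<alpha>' * l + l' * \<delta>) (\<delta>' * \<delta>) v" for v
    by (cases v) (simp add: algebra_simps)
  then have "Z = triangular (\<alpha>' * \<alpha>) (\<alpha>' * l + l' * \<delta>) (\<delta>' * \<delta>) ` X"
    unfolding 1 2 image_image by simp
  then show ?thesis unfolding triangular_equiv_def using 1 2 by (metis mult_eq_0_iff)
qed

lemma
  fixes X :: "('a::field \<times> 'a) set"
  assumes "\<alpha> \<noteq> 0" "\<delta> \<noteq> 0"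
  shows inj_triangular: "inj (triangular \<alpha> l \<delta>)"
    and subgrp_triangular: "subgrp X \<Longrightarrow> subgrp (triangular \<alpha> l \<delta> ` X)"
    and slice_triangular:
      "slice (triangular \<alpha> l \<delta> ` X) ((\<alpha> * m + l) / \<delta>) = (*) \<delta> ` slice X m"
proof -
  show inj: "inj (triangular \<alpha> l \<delta>)"
    by (rule injI) (use assms in \<open>auto\<close>)
  show "subgrp (triangular \<alpha> l \<delta> ` X)" if "subgrp X"
    by (rule subgrp_image[OF _ that]) (auto simp: algebra_simps)
  have mem: "triangular \<alpha> l \<delta> w \<in> triangular \<alpha> l \<delta> ` X \<longleftrightarrow> w \<in> X" for w
    using inj by (simp add: inj_image_mem_iff)
  show "slice (triangular \<alpha> l \<delta> ` X) ((\<alpha> * m + l) / \<delta>) = (*) \<delta> ` slice X m"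
  proof (intro set_eqI)
    fix y
    have "(\<alpha> * m + l) / \<delta> * y = \<alpha> * (m * (y / \<delta>)) + l * (y / \<delta>)"
      using assms by (simp add: field_simps)
    then have "y \<in> slice (triangular \<alpha> l \<delta> ` X) ((\<alpha> * m + l) / \<delta>) \<longleftrightarrow>
      triangular \<alpha> l \<delta> (m * (y / \<delta>), y / \<delta>) \<in> triangular \<alpha> l \<delta> ` X"
      using assms by (simp add: slice_def)
    also have "\<dots> \<longleftrightarrow> y / \<delta> \<in> slice X m" unfolding mem by (simp add: slice_def)
    also have "\<dots> \<longleftrightarrow> y \<in> (*) \<delta> ` slice X m"
      using assms by (auto simp: image_iff intro!: bexI[of _ "y / \<delta>"])
    finally show "y \<in> slice (triangular \<alpha> l \<delta> ` X) ((\<alpha> * m + l) / \<delta>) \<longleftrightarrow> y \<in> (*) \<delta> ` slice X m" .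
  qed
qed

lemma triangular_equiv_card_slices:
  fixes X Y :: "('a::field \<times> 'a) set"
  assumes "triangular_equiv X Y"
  shows "card {m. card (slice X m) = k} = card {m. card (slice Y m) = k}"
proof -
  obtain \<alpha> l \<delta> where *: "\<alpha> \<noteq> 0" "\<delta> \<noteq> 0" "Y = triangular \<alpha> l \<delta> ` X" using assms triangular_equiv_def by metis
  have inj: "inj_on ((*) \<delta>) S" for S using *(2) by (auto simp: inj_on_def)
  have c: "card (slice Y ((\<alpha> * m + l) / \<delta>)) = card (slice X m)" for m
    unfolding *(3) slice_triangular[OF *(1,2)] by (rule card_image[OF inj])
  have "bij_betw (\<lambda>m. (\<alpha> * m + l) / \<delta>) {m. card (slice X m) = k} {m. card (slice Y m) = k}"
  proof (rule bij_betw_byWitness[where f' = "\<lambda>n. (\<delta> * n - l) / \<alpha>"])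
    show "(\<lambda>n. (\<delta> * n - l) / \<alpha>) ` {m. card (slice Y m) = k} \<subseteq> {m. card (slice X m) = k}"
    proof clarify
      fix n
      show "card (slice X ((\<delta> * n - l) / \<alpha>)) = card (slice Y n)"
        using c[of "(\<delta> * n - l) / \<alpha>"] * by simp
    qed
  qed (use * c in auto)
  then show ?thesis by (rule bij_betw_same_card)
qed

text \<open>The group generated by \<open>(1, 0)\<close>, \<open>(a, 0)\<close>, \<open>(0, 1)\<close>, \<open>(b, a)\<close> and \<open>(g, c)\<close>.\<close>

definition normal_set :: "'a::field \<Rightarrow> 'a \<Rightarrow> 'a \<Rightarrow> 'a \<Rightarrow> ('a \<times> 'a) set" where
  "normal_set a c b g = (\<lambda>(i,j,h,l,k).
     (of3 i + of3 j * a + of3 l * b + of3 k * g, of3 h + of3 l * a + of3 k * c)) ` UNIV"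

lemma normal_set_iff: "q \<in> normal_set a c b g \<longleftrightarrow> (\<exists>i j l k h.
    q = (of3 i + of3 j * a + of3 l * b + of3 k * g, of3 h + of3 l * a + of3 k * c))"
  unfolding normal_set_def image_iff by (simp add: split_paired_Ex) (rule iffI; elim exE; intro exI)

fun lift :: "q3 \<Rightarrow> q5" where "lift (x2,x3,x4) = (0,0,x2,x3,x4)"

definition gf3s :: "gf3 list" where "gf3s = [0, 1, - 1]"

text \<open>The parameters \<open>c\<close>, \<open>b\<close>, \<open>g\<close> of a normal form, as coordinates with respect to \<open>a^2, a^3, a^4\<close>. The third
  generator \<open>c\<close> matters only up to sign, so its leading coefficient is 1. A shear clears the coefficient
  of \<open>a^2\<close> in \<open>b\<close> and, in \<open>g\<close>, the coefficient at the leading position of \<open>c\<close>.\<close>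

definition thirds :: "q3 list" where
  "thirds = (1,0,0) # [(x,1,0). x \<leftarrow> gf3s] @ [(x,y,1). x \<leftarrow> gf3s, y \<leftarrow> gf3s]"

definition betas :: "q3 list" where "betas = [(0,x,y). x \<leftarrow> gf3s, y \<leftarrow> gf3s]"

fun gammas :: "q3 \<Rightarrow> q3 list" where
  "gammas (c2,c3,c4) =
     (if c4 \<noteq> 0 then [(x,y,0). x \<leftarrow> gf3s, y \<leftarrow> gf3s]
      else if c3 \<noteq> 0 then [(x,0,y). x \<leftarrow> gf3s, y \<leftarrow> gf3s]
      else [(0,x,y). x \<leftarrow> gf3s, y \<leftarrow> gf3s])"

lemma set_gf3s [simp]: "set gf3s = UNIV"
  by (simp add: gf3_UNIV gf3s_def)

lemma thirds_iff: "(c2,c3,c4) \<in> set thirds \<longleftrightarrow>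
  c4 = 1 \<or> (c4 = 0 \<and> c3 = 1) \<or> (c4 = 0 \<and> c3 = 0 \<and> c2 = 1)"
  by (auto simp: thirds_def image_iff)

lemma betas_iff: "(b2,b3,b4) \<in> set betas \<longleftrightarrow> b2 = 0"
  by (auto simp: betas_def image_iff)

lemma gammas_iff: "(g2,g3,g4) \<in> set (gammas (c2,c3,c4)) \<longleftrightarrow>
   (if c4 \<noteq> 0 then g4 = 0 else if c3 \<noteq> 0 then g3 = 0 else g2 = 0)"
  by (auto simp: image_iff)

lemma gf3_cases: "x = 0 \<or> x = 1 \<or> x = (- 1 :: gf3)"
  using gf3_UNIV by blast

lemma gf3_sign: "x \<noteq> 0 \<Longrightarrow> x = 1 \<or> - x = (1 :: gf3)"
  using gf3_cases[of x] by auto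

lemma gf3_cancel:
  assumes "k * c2 = k' * c2" "k * c3 = k' * c3" "k * c4 = k' * c4" "(c2, c3, c4) \<noteq> (0 :: q3)"
  shows "k = k'"
  using assms gf3_cases[of c2] gf3_cases[of c3] gf3_cases[of c4] by (auto simp: zero_prod_def)

lemma third_sign:
  assumes "v \<noteq> 0"
  shows "v \<in> set thirds \<or> - v \<in> set thirds"
proof -
  obtain v2 v3 v4 where v: "v = (v2, v3, v4)" by (cases v)
  consider "v4 \<noteq> 0" | "v4 = 0" "v3 \<noteq> 0" | "v4 = 0" "v3 = 0" "v2 \<noteq> 0"
    using assms by (auto simp: v zero_prod_def)
  then show ?thesis
    by cases (use gf3_sign[of v2] gf3_sign[of v3] gf3_sign[of v4] in
      \<open>auto simp: v thirds_iff simp del: set_gf3s\<close>)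
qed

lemma thirds_nonzero: "c \<in> set thirds \<Longrightarrow> c \<noteq> 0"
  by (auto simp: thirds_def zero_prod_def)

context gf243
begin

lemma subgrp_of3:
  assumes "subgrp (H :: 'a set)" "x \<in> H"
  shows "of3 t * x \<in> H"
  using subgrpD[OF assms(1)] assms(2) by (cases t) auto

lemma subgrp_of3_pair:
  assumes "subgrp (H :: ('a \<times> 'a) set)" "(x, y) \<in> H"
  shows "(of3 t * x, of3 t * y) \<in> H"
  using subgrpD(1,3)[OF assms(1)] assms(2) by (cases t) (auto simp: zero_prod_def)

lemma card_le_9: "card {of3 i * x + of3 j * y | i j. True} \<le> 9" for x y :: 'a
proof -
  have "{of3 i * x + of3 j * y | i j. True} = (\<lambda>(i,j). of3 i * x + of3 j * y) ` UNIV" by auto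
  then have "card {of3 i * x + of3 j * y | i j. True} \<le> card (UNIV :: (gf3 \<times> gf3) set)"
    by (metis card_image_le finite)
  then show ?thesis by (simp add: card_gf3)
qed

lemma card_normal_set:
  assumes a: "(a::'a) \<notin> range of3" and c: "c \<noteq> 0"
  shows "card (normal_set a (ev a (lift c)) b g) = 3 ^ 5"
proof -
  obtain c2 c3 c4 where C: "c = (c2,c3,c4)" by (cases c)
  have *: "of3 h + of3 l * a + of3 k * ev a (lift c) = ev a (h, l, k * c2, k * c3, k * c4)" for h l k
    by (simp add: C algebra_simps)
  have **: "of3 h + of3 l * a = ev a (h, l, 0, 0, 0)" for h l
    by (simp add: C algebra_simps)
  have kc: "k = k'" if "k * c2 = k' * c2" "k * c3 = k' * c3" "k * c4 = k' * c4" for k k'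
    using that c unfolding C by (rule gf3_cancel)
  have "inj (\<lambda>(i,j,h,l,k). (of3 i + of3 j * a + of3 l * b + of3 k * g, of3 h + of3 l * a + of3 k * ev a (lift c)))"
  proof (rule injI)
    fix v w :: "gf3 \<times> gf3 \<times> gf3 \<times> gf3 \<times> gf3"
    obtain i j h l k where v: "v = (i,j,h,l,k)" by (cases v)
    obtain i' j' h' l' k' where w: "w = (i',j',h',l',k')" by (cases w)
    assume "(\<lambda>(i,j,h,l,k). (of3 i + of3 j * a + of3 l * b + of3 k * g, of3 h + of3 l * a + of3 k * ev a (lift c))) v
      = (\<lambda>(i,j,h,l,k). (of3 i + of3 j * a + of3 l * b + of3 k * g, of3 h + of3 l * a + of3 k * ev a (lift c))) w"
    then have e: "of3 i + of3 j * a + of3 l * b + of3 k * g = of3 i' + of3 j' * a + of3 l' * b + of3 k' * g"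
     "of3 h + of3 l * a + of3 k * ev a (lift c) = of3 h' + of3 l' * a + of3 k' * ev a (lift c)"
      unfolding v w by (simp_all del: ev.simps)
    have 1: "h = h' \<and> l = l' \<and> k = k'" using e(2) unfolding * ev_inject[OF a] using kc by auto
    then have "of3 i + of3 j * a = of3 i' + of3 j' * a" using e(1) by simp
    then show "v = w" using 1 unfolding v w ** ev_inject[OF a] by simp
  qed
  then show ?thesis unfolding normal_set_def by (simp add: card_image card_gf3)
qed

lemma line_normal_form:
  assumes X: "subgrp (X :: ('a \<times> 'a) set)" and A: "card (slice_inf X) = 9"
  obtains e a p where "e \<noteq> 0" "a \<notin> range of3" "p \<in> set quintics" "a ^ 5 = ev a p"
    "e \<in> slice_inf X" "a * e \<in> slice_inf X"
proof -
  have sA: "subgrp (slice_inf X)"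
    using subgrpD[OF X] unfolding subgrp_def slice_inf_def by (force simp: zero_prod_def)
  have "\<not> slice_inf X \<subseteq> {0}" using A card_mono[of "{0}" "slice_inf X"] by auto
  then obtain x1 where x1: "x1 \<in> slice_inf X" "x1 \<noteq> 0" by auto
  have "\<not> slice_inf X \<subseteq> {0, x1, - x1}"
  proof
    assume "slice_inf X \<subseteq> {0, x1, - x1}"
    then have "9 \<le> card {0, x1, - x1}" using A card_mono[of "{0, x1, - x1}" "slice_inf X"] by auto
    also have "\<dots> \<le> 3" by (metis card_3_iff card_insert_le_m1 card.empty card.insert insert_absorb2 le_refl numeral_3_eq_3 card_length length_Cons list.size(3) list.set) 
    finally show False by simp
  qed
  then obtain x2 where x2: "x2 \<in> slice_inf X" "x2 \<notin> {0, x1, - x1}" by blast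
  define b where "b = x2 / x1"
  have x2b: "x2 = b * x1" using x1 by (simp add: b_def)
  have b: "b \<notin> range of3"
  proof
    assume "b \<in> range of3"
    then obtain t where "b = of3 t" by blast
    then show False using x2 x2b by (cases t) auto
  qed
  obtain s r u t a p where d: "ev b (t,u,0,0,0) \<noteq> 0" and a: "a = ev b (r,s,0,0,0) / ev b (t,u,0,0,0)"
    and a': "a \<notin> range of3" and p: "p \<in> set quintics" "a ^ 5 = ev a p"
    by (rule quintic_normal_form[OF b])
  define e where "e = ev b (t,u,0,0,0) * x1"
  have e: "e = of3 t * x1 + of3 u * x2" by (simp add: e_def x2b algebra_simps)
  have "a * e = ev b (r,s,0,0,0) * x1" using d unfolding a e_def by (simp del: ev.simps)
  then have ae: "a * e = of3 r * x1 + of3 s * x2" by (simp add: x2b algebra_simps)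
  have "e \<noteq> 0" using d x1 by (simp add: e_def)
  moreover have "e \<in> slice_inf X" "a * e \<in> slice_inf X"
    by (unfold ae, unfold e) (intro subgrpD(2)[OF sA] subgrp_of3[OF sA] x1 x2)+
  ultimately show ?thesis using that a' p by blast
qed

text \<open>The fibres of the projection are cosets of \<open>slice_inf X\<close>, hence of order nine.\<close>

lemma card_projection:
  assumes X: "subgrp (X :: ('a \<times> 'a) set)" "card X = 3 ^ 5" and A: "card (slice_inf X) = 9"
  shows "27 \<le> card (snd ` X)"
proof -
  have fib: "card {v \<in> X. snd v = y} \<le> 9" for y
  proof (cases "\<exists>x. (x, y) \<in> X")
    case True
    then obtain x where x: "(x, y) \<in> X" by blast
    have "{v \<in> X. snd v = y} \<subseteq> (\<lambda>z. (x + z, y)) ` slice_inf X"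
    proof
      fix v assume v: "v \<in> {v \<in> X. snd v = y}"
      then obtain w where w: "v = (w, y)" "(w, y) \<in> X" by (cases v) auto
      have "(w - x, 0) \<in> X" using subgrpD(4)[OF X(1) w(2) x] by simp
      then show "v \<in> (\<lambda>z. (x + z, y)) ` slice_inf X" unfolding w slice_inf_def
        by (intro image_eqI[of _ _ "w - x"]) auto
    qed
    then have "card {v \<in> X. snd v = y} \<le> card (slice_inf X)"
      by (meson card_image_le card_mono finite_field(2) finite_imageI le_trans)
    then show ?thesis using A by simp
  next
    case False
    then have "{v \<in> X. snd v = y} = {}" by auto
    then show ?thesis by (metis card.empty zero_le)
  qed
  have fX: "finite X" using X(2) by (metis card.infinite power_eq_0_iff zero_neq_numeral)
  have "card X = card (\<Union>y\<in>snd ` X. {v \<in> X. snd v = y})" by (rule arg_cong[of _ _ card]) auto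
  also have "\<dots> \<le> (\<Sum>y\<in>snd ` X. card {v \<in> X. snd v = y})" by (rule card_UN_le) (use fX in simp)
  also have "\<dots> \<le> (\<Sum>y\<in>snd ` X. 9)" by (rule sum_mono) (rule fib)
  finally show ?thesis using X(2) by simp
qed

text \<open>The groups \<open>C\<close> and \<open>{y. a y \<in> C}\<close> have the same order, and \<open>27 * 27 > 243\<close>.\<close>

lemma large_subgrp_meets:
  assumes C: "subgrp (C :: 'a set)" "27 \<le> card C" and a: "a \<noteq> 0"
  obtains z where "z \<noteq> 0" "z \<in> C" "a * z \<in> C"
proof -
  have sD: "subgrp {y. a * y \<in> C}"
    using subgrpD[OF C(1)] unfolding subgrp_def by (auto simp: algebra_simps)
  have "(*) a ` {y. a * y \<in> C} = C" using a by (auto simp: image_iff) (metis nonzero_mult_div_cancel_left times_divide_eq_right)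
  moreover have "inj_on ((*) a) {y. a * y \<in> C}" using a by (auto simp: inj_on_def)
  ultimately have cD: "card {y. a * y \<in> C} = card C" by (metis card_image)
  have "C \<inter> {y. a * y \<in> C} \<noteq> {0}"
  proof
    assume "C \<inter> {y. a * y \<in> C} = {0}"
    then have "card C * card {y. a * y \<in> C} \<le> card (UNIV :: 'a set)"
      by (intro card_subgrp_product_le[OF C(1) sD]) auto
    moreover have "27 * 27 \<le> card C * card C" using C(2) by (intro mult_mono) auto
    ultimately show False using cD card_field by simp
  qed
  moreover have "0 \<in> C \<inter> {y. a * y \<in> C}" using subgrpD(1)[OF C(1)] by simp
  ultimately show ?thesis using that by blast
qed

lemma lift_minus: "lift (- v) = - lift v"
  by (cases v) simp

text \<open>Scaling the first coordinate by \<open>1 / e\<close> and the second by \<open>1 / z\<close> puts 1 and \<open>a\<close> into both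
  \<open>slice_inf\<close> and the projection. What remains free is the preimage \<open>l\<close> of 1, which varies in a
  coset of the group generated by 1 and \<open>a\<close>: a shear by \<open>l\<close> moves that preimage to \<open>(0, 1)\<close>, and the two
  coefficients of \<open>l\<close> are used to normalise the preimages of \<open>a\<close> and \<open>c\<close>.\<close>

lemma normal_form:
  assumes X: "subgrp (X :: ('a \<times> 'a) set)" "card X = 3 ^ 5" and A: "card (slice_inf X) = 9"
  obtains a p c b g where "a \<notin> range of3" "p \<in> set quintics" "a ^ 5 = ev a p"
    "c \<in> set thirds" "b \<in> set betas" "g \<in> set (gammas c)"
    "triangular_equiv X (normal_set a (ev a (lift c)) (ev a (lift b)) (ev a (lift g)))"
proof -
  obtain e a p where e: "e \<noteq> 0" and a: "a \<notin> range of3" and p: "p \<in> set quintics" "a ^ 5 = ev a p"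
    and eA: "e \<in> slice_inf X" "a * e \<in> slice_inf X"
    by (rule line_normal_form[OF X(1) A])
  have a0: "a \<noteq> 0" using a by (metis of3.simps(1) rangeI)
  obtain z where z: "z \<noteq> 0" "z \<in> snd ` X" "a * z \<in> snd ` X"
    by (rule large_subgrp_meets[OF subgrp_image[OF snd_add X(1)] card_projection[OF X A] a0])
  define Y where "Y = triangular (1/e) 0 (1/z) ` X"
  have nz: "1/e \<noteq> 0" "1/z \<noteq> 0" using e z by auto
  have XY: "triangular_equiv X Y" unfolding Y_def by (rule triangular_equivI[OF nz])
  have Y: "subgrp Y" unfolding Y_def by (rule subgrp_triangular[OF nz X(1)])
  have Ymem: "(x / e, y / z) \<in> Y" if "(x, y) \<in> X" for x y
    using imageI[OF that, of "triangular (1/e) 0 (1/z)"] unfolding Y_def by simp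
  have Y1: "(1, 0) \<in> Y" "(a, 0) \<in> Y"
    using Ymem[of e 0] Ymem[of "a * e" 0] eA e by (auto simp: slice_inf_def)
  have sndY: "snd ` Y = (\<lambda>y. y / z) ` snd ` X"
    unfolding Y_def image_image by (intro image_cong) auto
  have one_in: "1 \<in> snd ` Y" "a \<in> snd ` Y"
    unfolding sndY by (rule image_eqI[OF _ z(2)] image_eqI[OF _ z(3)], use z(1) in simp)+
  have "inj_on (\<lambda>y. y / z) S" for S using z(1) by (auto simp: inj_on_def)
  then have cY: "27 \<le> card (snd ` Y)" unfolding sndY using card_projection[OF X A]
    by (simp add: card_image)
  have C: "subgrp (snd ` Y)" by (rule subgrp_image[OF snd_add Y])
  have "\<not> snd ` Y \<subseteq> {of3 i * 1 + of3 j * a | i j. True}"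
  proof
    assume "snd ` Y \<subseteq> {of3 i * 1 + of3 j * a | i j. True}"
    then have "card (snd ` Y) \<le> card {of3 i * 1 + of3 j * a | i j. True}"
      by (intro card_mono) auto
    then show False using card_le_9[of 1 a] cY by simp
  qed
  then obtain y where y: "y \<in> snd ` Y" "y \<notin> {of3 i * 1 + of3 j * a | i j. True}" by blast
  obtain y0 y1 y2 y3 y4 where yy: "y = ev a (y0,y1,y2,y3,y4)"
    using bij_ev[OF a] by (metis bij_pointE prod_cases5)
  have "ev a (lift (y2,y3,y4)) = y - of3 y0 * 1 - of3 y1 * a" unfolding yy by simp
  then have w: "ev a (lift (y2,y3,y4)) \<in> snd ` Y"
    using subgrpD(4)[OF C] subgrp_of3[OF C] one_in y(1) by metis
  have "(y2,y3,y4) \<noteq> 0"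
  proof
    assume "(y2,y3,y4) = 0"
    then have "y = of3 y0 * 1 + of3 y1 * a" unfolding yy by (simp add: zero_prod_def)
    then show False using y(2) by blast
  qed
  then obtain c where c: "c \<in> set thirds" "ev a (lift c) \<in> snd ` Y"
    using third_sign[of "(y2,y3,y4)"] w subgrpD(3)[OF C w] by (metis ev_uminus lift_minus)
  obtain x1 xa xc where x: "(x1, 1) \<in> Y" "(xa, a) \<in> Y" "(xc, ev a (lift c)) \<in> Y"
    using one_in c(2) by auto
  obtain w0 w1 w2 w3 w4 where w: "xa - x1 * a = ev a (w0,w1,w2,w3,w4)"
    using bij_ev[OF a] by (metis bij_pointE prod_cases5)
  obtain c2 c3 c4 where cc: "c = (c2,c3,c4)" by (cases c)
  obtain v0 v1 v2 v3 v4 where v: "xc - (x1 + of3 w2 * a) * ev a (lift c) = ev a (v0,v1,v2,v3,v4)"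
    using bij_ev[OF a] by (metis bij_pointE prod_cases5)
  \<comment> \<open>Adding \<open>w2 a\<close> to \<open>x1\<close> clears the coefficient of \<open>a^2\<close> in the preimage of \<open>a\<close>; adding a constant then
    affects only lower coefficients there, and clears the leading position of \<open>c\<close> in the preimage of \<open>c\<close>.\<close>
  define i where "i = (if c4 \<noteq> 0 then v4 else if c3 \<noteq> 0 then v3 else v2)"
  define l where "l = x1 + of3 w2 * a + of3 i"
  define b where "b = (0::gf3, w3, w4)"
  define g where "g = (v2 - i * c2, v3 - i * c3, v4 - i * c4)"
  have b: "b \<in> set betas" by (simp add: b_def betas_iff)
  have g: "g \<in> set (gammas c)" using c(1) unfolding g_def cc gammas_iff thirds_iff i_def by auto
  define Z where "Z = triangular 1 (- l) 1 ` Y"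
  have YZ: "triangular_equiv Y Z" unfolding Z_def by (rule triangular_equivI) auto
  have Z: "subgrp Z" unfolding Z_def by (rule subgrp_triangular[OF _ _ Y]) auto
  have Zmem: "(x - l * y, y) \<in> Z" if "(x, y) \<in> Y" for x y
    using imageI[OF that, of "triangular 1 (- l) 1"] unfolding Z_def by simp
  note Zadd = subgrpD(2)[OF Z] and Zof3 = subgrp_of3_pair[OF Z]
  have Z1: "(1, 0) \<in> Z" "(a, 0) \<in> Z" using Zmem[OF Y1(1)] Zmem[OF Y1(2)] by simp_all
  have "(x1 - l, 1) \<in> Z" using Zmem[OF x(1)] by simp
  from Zadd[OF this Zadd[OF Zof3[OF Z1(1), of i] Zof3[OF Z1(2), of w2]]]
  have Z2: "(0, 1) \<in> Z" by (simp add: l_def algebra_simps)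
  have "xa - l * a = of3 w0 + of3 (w1 - i) * a + ev a (lift b)"
  proof -
    have "xa - l * a = (xa - x1 * a) - of3 w2 * a * a - of3 i * a" by (simp add: l_def algebra_simps)
    then show ?thesis unfolding w b_def by (simp add: algebra_simps power2_eq_square)
  qed
  then have "(ev a (lift b), a) = (xa - l * a, a) + ((of3 (- w0) * 1, of3 (- w0) * 0) + (of3 (i - w1) * a, of3 (i - w1) * 0))"
    by (simp add: algebra_simps)
  then have Z3: "(ev a (lift b), a) \<in> Z"
    using Zadd[OF Zmem[OF x(2)] Zadd[OF Zof3[OF Z1(1)] Zof3[OF Z1(2)]]] by metis
  have "xc - l * ev a (lift c) = of3 v0 + of3 v1 * a + ev a (lift g)"
  proof -
    have "xc - l * ev a (lift c) = (xc - (x1 + of3 w2 * a) * ev a (lift c)) - of3 i * ev a (lift c)"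
      unfolding l_def by (simp add: algebra_simps del: ev.simps)
    also have "\<dots> = ev a (v0,v1,v2,v3,v4) - of3 i * ev a (lift c)" unfolding v ..
    also have "\<dots> = of3 v0 + of3 v1 * a + ev a (lift g)"
      unfolding g_def cc by (simp add: algebra_simps)
    finally show ?thesis .
  qed
  then have "(ev a (lift g), ev a (lift c)) = (xc - l * ev a (lift c), ev a (lift c)) +
     ((of3 (- v0) * 1, of3 (- v0) * 0) + (of3 (- v1) * a, of3 (- v1) * 0))"
    by (simp add: algebra_simps)
  then have Z4: "(ev a (lift g), ev a (lift c)) \<in> Z"
    using Zadd[OF Zmem[OF x(3)] Zadd[OF Zof3[OF Z1(1)] Zof3[OF Z1(2)]]] by metis
  let ?N = "normal_set a (ev a (lift c)) (ev a (lift b)) (ev a (lift g))"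
  \<comment> \<open>All five generators of the normal form lie in \<open>Z\<close>, and the orders agree.\<close>
  have sub: "?N \<subseteq> Z"
  proof
    fix q assume "q \<in> ?N"
    then obtain i j h l k where "q = (of3 i + of3 j * a + of3 l * ev a (lift b) + of3 k * ev a (lift g),
        of3 h + of3 l * a + of3 k * ev a (lift c))"
      unfolding normal_set_iff by blast
    then have "q = (of3 i * 1, of3 i * 0) + ((of3 j * a, of3 j * 0) + ((of3 h * 0, of3 h * 1) +
       ((of3 l * ev a (lift b), of3 l * a) + (of3 k * ev a (lift g), of3 k * ev a (lift c)))))"
      by (simp add: algebra_simps del: ev.simps)
    then show "q \<in> Z" by (elim ssubst) (intro Zadd Zof3 Z1 Z2 Z3 Z4)
  qed
  have "card Z = card Y" unfolding Z_def
    by (intro card_image inj_on_subset[OF inj_triangular]) auto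
  also have "\<dots> = card X" unfolding Y_def
    by (intro card_image inj_on_subset[OF inj_triangular] nz) auto
  finally have cZ: "card Z = 3 ^ 5" using X(2) by simp
  then have "finite Z" by (metis card.infinite power_eq_0_iff zero_neq_numeral)
  then have "?N = Z" using sub cZ card_normal_set[OF a thirds_nonzero[OF c(1)]] by (intro card_subset_eq) auto
  then have "triangular_equiv X ?N" using triangular_equiv_trans[OF XY YZ] by simp
  then show ?thesis using that a p c(1) b g by blast
qed

end

section \<open>Slices of order nine as rank conditions over three elements\<close>

fun scl3 :: "gf3 \<Rightarrow> q3 \<Rightarrow> q3" where
  "scl3 s (x,y,z) = (s * x, s * y, s * z)"

lemma scl3_simps [simp]: "scl3 0 v = 0" "scl3 1 v = v" "scl3 (- s) v = - scl3 s v" "scl3 s 0 = 0"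
  by (cases v; simp add: zero_prod_def)+

lemma scl3_add: "scl3 (s + t) v = scl3 s v + scl3 t v"
  by (cases v) (simp add: algebra_simps)

lemma scl3_diff: "scl3 (s - t) v = scl3 s v - scl3 t v"
  by (cases v) (simp add: algebra_simps)

lemma scl3_scl3: "scl3 s (scl3 t v) = scl3 (s * t) v"
  by (cases v) (simp add: algebra_simps)

lemma scl3_eq_0: "k \<noteq> 0 \<Longrightarrow> scl3 s k = 0 \<longleftrightarrow> s = 0"
  using gf3_cases[of s] by auto

lemma par_iff: "par k v \<longleftrightarrow> (\<exists>t. v = scl3 t k)"
proof
  assume "par k v"
  then have "v = scl3 0 k \<or> v = scl3 1 k \<or> v = scl3 (- 1) k"
    by (simp add: par_def)
  then show "\<exists>t. v = scl3 t k" by blast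
next
  assume "\<exists>t. v = scl3 t k"
  then obtain t where "v = scl3 t k" by blast
  then show "par k v" using gf3_cases[of t] by (auto simp: par_def)
qed

lemma not_par_independent:
  assumes "k \<noteq> 0" "\<not> par k v" "scl3 s k + scl3 t v = 0"
  shows "s = 0 \<and> t = 0"
proof -
  have "t = 0"
  proof (rule ccontr)
    assume "t \<noteq> 0"
    have "scl3 t (scl3 s k + scl3 t v) = scl3 t 0" using assms(3) by simp
    moreover have "scl3 t (scl3 s k + scl3 t v) = scl3 (t * s) k + v"
      using \<open>t \<noteq> 0\<close> gf3_cases[of t] by auto
    ultimately have "v = - scl3 (t * s) k" by (simp add: eq_neg_iff_add_eq_0 add.commute)
    then have "v = scl3 (- (t * s)) k" by simp
    then show False using assms(2) par_iff by blast
  qed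
  then show ?thesis using assms(1,3) scl3_eq_0 by simp
qed

text \<open>The linear relations between three vectors; there are nine of them exactly if the vectors span a
  line, which \<open>rank1\<close> tests by comparing them with the first nonzero one.\<close>

definition ker3 :: "q3 \<Rightarrow> q3 \<Rightarrow> q3 \<Rightarrow> q3 set" where
  "ker3 k0 k1 k2 = {(h,l,k). scl3 h k0 + scl3 l k1 + scl3 k k2 = 0}"

definition rank1 :: "q3 \<Rightarrow> q3 \<Rightarrow> q3 \<Rightarrow> bool" where
  "rank1 k0 k1 k2 \<longleftrightarrow>
     (if k0 \<noteq> 0 then par k0 k1 \<and> par k0 k2 else if k1 \<noteq> 0 then par k1 k2 else k2 \<noteq> 0)"

lemma ker3_diff:
  assumes "(h,l,k) \<in> ker3 k0 k1 k2" "(h',l',k') \<in> ker3 k0 k1 k2"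
  shows "scl3 (h - h') k0 + scl3 (l - l') k1 + scl3 (k - k') k2 = 0"
proof -
  have "scl3 (h - h') k0 + scl3 (l - l') k1 + scl3 (k - k') k2 =
    (scl3 h k0 + scl3 l k1 + scl3 k k2) - (scl3 h' k0 + scl3 l' k1 + scl3 k' k2)"
    by (simp add: scl3_diff algebra_simps)
  then show ?thesis using assms by (simp add: ker3_def)
qed

lemma inj_on_ker3I:
  fixes f :: "q3 \<Rightarrow> gf3"
  assumes zero: "\<And>h l k. scl3 h k0 + scl3 l k1 + scl3 k k2 = 0 \<Longrightarrow> f (h,l,k) = 0 \<Longrightarrow> h = 0 \<and> l = 0 \<and> k = 0"
    and diff: "\<And>v w. f (v - w) = f v - f w"
  shows "inj_on f (ker3 k0 k1 k2)"
proof (rule inj_onI)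
  fix v w assume vw: "v \<in> ker3 k0 k1 k2" "w \<in> ker3 k0 k1 k2" "f v = f w"
  obtain h l k where v: "v = (h,l,k)" by (cases v)
  obtain h' l' k' where w: "w = (h',l',k')" by (cases w)
  have "h - h' = 0 \<and> l - l' = 0 \<and> k - k' = 0"
    using zero[OF ker3_diff[of h l k k0 k1 k2 h' l' k']] vw diff[of v w] by (simp add: v w)
  then show "v = w" by (simp add: v w)
qed

lemma card_neq_9_if_inj:
  fixes f :: "q3 \<Rightarrow> gf3"
  assumes "inj_on f S"
  shows "card S \<noteq> 9"
proof -
  have "card S = card (f ` S)" using assms by (simp add: card_image)
  also have "\<dots> \<le> card (UNIV :: gf3 set)" by (rule card_mono) auto
  finally show ?thesis by (simp add: card_gf3)
qed

lemma card_9_if_param: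
  fixes f :: "gf3 \<times> gf3 \<Rightarrow> q3"
  assumes "S = range f" "inj f"
  shows "card S = 9"
  using assms by (simp add: card_image card_gf3)

text \<open>In rank one, two of the coefficients of a relation are free and determine the third. If two of the
  vectors are independent, a single coefficient determines the whole relation.\<close>

lemma card_ker3_eq_9: "card (ker3 k0 k1 k2) = 9 \<longleftrightarrow> rank1 k0 k1 k2"
proof -
  consider "k0 \<noteq> 0" "par k0 k1" "par k0 k2" | "k0 \<noteq> 0" "\<not> par k0 k1"
    | "k0 \<noteq> 0" "par k0 k1" "\<not> par k0 k2"
    | "k0 = 0" "k1 \<noteq> 0" "par k1 k2" | "k0 = 0" "k1 \<noteq> 0" "\<not> par k1 k2"
    | "k0 = 0" "k1 = 0" "k2 \<noteq> 0" | "k0 = 0" "k1 = 0" "k2 = 0" by blast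
  then show ?thesis
  proof cases
    case 1
    then obtain t u where tu: "k1 = scl3 t k0" "k2 = scl3 u k0" by (auto simp: par_iff)
    have "(h,l,k) \<in> ker3 k0 k1 k2 \<longleftrightarrow> h = - (l * t + k * u)" for h l k
    proof -
      have "(h,l,k) \<in> ker3 k0 k1 k2 \<longleftrightarrow> scl3 (h + (l * t + k * u)) k0 = 0"
        by (simp add: ker3_def tu scl3_scl3 scl3_add add.assoc)
      then show ?thesis by (simp only: scl3_eq_0[OF 1(1)] eq_neg_iff_add_eq_0)
    qed
    then have "ker3 k0 k1 k2 = range (\<lambda>(l,k). (- (l * t + k * u), l, k))" by (auto simp: image_iff)
    then have "card (ker3 k0 k1 k2) = 9" by (rule card_9_if_param) (auto simp: inj_def)
    then show ?thesis using 1 by (simp add: rank1_def)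
  next
    case 2
    have "inj_on (\<lambda>(h,l,k). k) (ker3 k0 k1 k2)"
      by (rule inj_on_ker3I) (use not_par_independent[OF 2] in auto)
    then show ?thesis using card_neq_9_if_inj 2 by (auto simp: rank1_def)
  next
    case 3
    then obtain t where t: "k1 = scl3 t k0" by (auto simp: par_iff)
    have "inj_on (\<lambda>(h,l,k). l) (ker3 k0 k1 k2)"
      by (rule inj_on_ker3I) (use not_par_independent[OF 3(1,3)] in auto)
    then show ?thesis using card_neq_9_if_inj 3 by (auto simp: rank1_def)
  next
    case 4
    then obtain u where u: "k2 = scl3 u k1" by (auto simp: par_iff)
    have "(h,l,k) \<in> ker3 k0 k1 k2 \<longleftrightarrow> l = - (k * u)" for h l k
    proof -
      have "(h,l,k) \<in> ker3 k0 k1 k2 \<longleftrightarrow> scl3 (l + k * u) k1 = 0"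
        using 4(1) by (simp add: ker3_def u scl3_scl3 scl3_add)
      then show ?thesis by (simp only: scl3_eq_0[OF 4(2)] eq_neg_iff_add_eq_0)
    qed
    then have "ker3 k0 k1 k2 = range (\<lambda>(h,k). (h, - (k * u), k))" by (auto simp: image_iff)
    then have "card (ker3 k0 k1 k2) = 9" by (rule card_9_if_param) (auto simp: inj_def)
    then show ?thesis using 4 by (simp add: rank1_def)
  next
    case 5
    have "inj_on (\<lambda>(h,l,k). h) (ker3 k0 k1 k2)"
      by (rule inj_on_ker3I) (use not_par_independent[OF 5(2,3)] 5(1) in auto)
    then show ?thesis using card_neq_9_if_inj 5 by (auto simp: rank1_def)
  next
    case 6
    have "ker3 k0 k1 k2 = range (\<lambda>(h,l). (h, l, 0))" 
      using 6 scl3_eq_0[OF 6(3)] by (auto simp: ker3_def image_iff)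
    then have "card (ker3 k0 k1 k2) = 9" by (rule card_9_if_param) (auto simp: inj_def)
    then show ?thesis using 6 by (simp add: rank1_def)
  next
    case 7
    then have "ker3 k0 k1 k2 = UNIV" by (auto simp: ker3_def)
    then show ?thesis using 7 by (simp add: rank1_def card_gf3)
  qed
qed

lemma ker3_UNIV:
  assumes "card (ker3 k0 k1 k2) \<ge> 27"
  shows "k0 = 0 \<and> k1 = 0 \<and> k2 = 0"
proof -
  have "card (ker3 k0 k1 k2) = CARD(q3)"
    using assms card_mono[of UNIV "ker3 k0 k1 k2"] by (simp add: card_gf3)
  then have "ker3 k0 k1 k2 = UNIV" by (intro card_eq_UNIV_imp_eq_UNIV) simp_all
  then have "(1,0,0) \<in> ker3 k0 k1 k2" "(0,1,0) \<in> ker3 k0 k1 k2" "(0,0,1) \<in> ker3 k0 k1 k2" by auto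
  then show ?thesis by (simp add: ker3_def)
qed

fun hi :: "q5 \<Rightarrow> q3" where "hi (x0,x1,x2,x3,x4) = (x2,x3,x4)"

lemma hi_add: "hi (v + w) = hi v + hi w" and hi_diff: "hi (v - w) = hi v - hi w"
  and hi_scl: "hi (scl s v) = scl3 s (hi v)" and hi_lift: "hi (lift u) = u"
  by (cases v; cases w; cases u; simp)+

definition rank1_count :: "q5 \<Rightarrow> q3 \<Rightarrow> q3 \<Rightarrow> q3 \<Rightarrow> nat" where
  "rank1_count p c b g = card {M. rank1 (hi M) (hi (shift p M) - b) (hi (mul p (lift c) M) - g)}"

context gf243
begin

lemma in_line_iff_hi:
  assumes "(a::'a) \<notin> range of3"
  shows "(\<exists>i j. ev a w = of3 i + of3 j * a) \<longleftrightarrow> hi w = 0"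
proof -
  obtain w0 w1 w2 w3 w4 where w: "w = (w0,w1,w2,w3,w4)" by (cases w)
  have "(ev a w = of3 i + of3 j * a) \<longleftrightarrow> w = (i,j,0,0,0)" for i j
    using ev_inject[OF assms, of w "(i,j,0,0,0)"] by simp
  then show ?thesis by (auto simp: w zero_prod_def)
qed

text \<open>An element \<open>h + l a + k c\<close> of the projection is the second coordinate only of the pairs with first
  coordinate in the coset of \<open>l b + k g\<close> modulo the group generated by 1 and \<open>a\<close>. So it lies in the slice
  at \<open>m\<close> exactly if \<open>(h, l, k)\<close> is a relation between \<open>m\<close>, \<open>m a - b\<close> and \<open>m c - g\<close> modulo that group, and the
  coefficients of \<open>a^2, a^3, a^4\<close> are coordinates for the quotient.\<close>

lemma card_slice_normal_set:
  assumes a: "(a::'a) \<notin> range of3" and p: "a ^ 5 = ev a p" and c: "c \<noteq> 0"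
  shows "card (slice (normal_set a (ev a (lift c)) (ev a (lift b)) (ev a (lift g))) (ev a M)) =
    card (ker3 (hi M) (hi (shift p M) - b) (hi (mul p (lift c) M) - g))" (is "card ?S = card ?K")
proof -
  define f :: "q3 \<Rightarrow> 'a" where "f = (\<lambda>(h,l,k). of3 h + of3 l * a + of3 k * ev a (lift c))"
  obtain c2 c3 c4 where C: "c = (c2,c3,c4)" by (cases c)
  have f: "f (h,l,k) = ev a (h, l, k * c2, k * c3, k * c4)" for h l k
    by (simp add: f_def C algebra_simps)
  have kc: "k = k'" if "k * c2 = k' * c2" "k * c3 = k' * c3" "k * c4 = k' * c4" for k k'
    using that c unfolding C by (rule gf3_cancel)
  have "inj f"
  proof (rule injI)
    fix v w assume e: "f v = f w"
    obtain h l k where v: "v = (h,l,k)" by (cases v)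
    obtain h' l' k' where w: "w = (h',l',k')" by (cases w)
    show "v = w" using e unfolding v w f ev_inject[OF a] using kc by auto
  qed
  have K: "(h,l,k) \<in> ?K \<longleftrightarrow> (\<exists>i j. ev a M * f (h,l,k) = of3 i + of3 j * a + of3 l * ev a (lift b) + of3 k * ev a (lift g))"
    for h l k
  proof -
    define w where "w = scl h M + scl l (shift p M - lift b) + scl k (mul p (lift c) M - lift g)"
    have "ev a w = ev a M * f (h,l,k) - of3 l * ev a (lift b) - of3 k * ev a (lift g)"
      unfolding w_def f_def using p
      by (simp add: algebra_simps del: ev.simps)
    then have "ev a w = of3 i + of3 j * a \<longleftrightarrow>
      ev a M * f (h,l,k) = of3 i + of3 j * a + of3 l * ev a (lift b) + of3 k * ev a (lift g)" for i j
      by (simp only: diff_eq_eq) (simp only: ac_simps)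
    moreover have "hi w = scl3 h (hi M) + scl3 l (hi (shift p M) - b) + scl3 k (hi (mul p (lift c) M) - g)"
      unfolding w_def by (simp only: hi_add hi_diff hi_scl hi_lift)
    moreover have "(h,l,k) \<in> ?K \<longleftrightarrow> (\<exists>i j. ev a w = of3 i + of3 j * a)"
      unfolding in_line_iff_hi[OF a] calculation(2) by (simp add: ker3_def)
    ultimately show ?thesis by simp
  qed
  have "?S = f ` ?K"
  proof (intro set_eqI iffI)
    fix y assume "y \<in> ?S"
    then obtain i j l k h where *: "ev a M * y = of3 i + of3 j * a + of3 l * ev a (lift b) + of3 k * ev a (lift g)"
      "y = f (h,l,k)" unfolding slice_def mem_Collect_eq normal_set_iff f_def prod.case prod.inject by blast
    then have "(h,l,k) \<in> ?K" unfolding K by blast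
    then show "y \<in> f ` ?K" using * by blast
  next
    fix y assume "y \<in> f ` ?K"
    then obtain h l k where y: "y = f (h,l,k)" "(h,l,k) \<in> ?K" by auto
    then show "y \<in> ?S" unfolding K slice_def mem_Collect_eq normal_set_iff y f_def prod.case prod.inject by blast
  qed
  then show ?thesis using \<open>inj f\<close> by (metis card_image inj_on_subset subset_UNIV)
qed

lemma card_slice_inf_normal_set:
  assumes a: "(a::'a) \<notin> range of3" and c: "c \<noteq> 0"
  shows "card (slice_inf (normal_set a (ev a (lift c)) b g)) = 9"
proof -
  obtain c2 c3 c4 where C: "c = (c2,c3,c4)" by (cases c)
  have z: "of3 h + of3 l * a + of3 k * ev a (lift c) = 0 \<longleftrightarrow> h = 0 \<and> l = 0 \<and> k = 0" for h l k
  proof -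
    have "of3 h + of3 l * a + of3 k * ev a (lift c) = ev a (h, l, k * c2, k * c3, k * c4)"
      by (simp add: C algebra_simps)
    then show ?thesis using c gf3_cases[of c2] gf3_cases[of c3] gf3_cases[of c4]
      by (auto simp: C ev_eq_0[OF a] zero_prod_def simp del: ev.simps)
  qed
  have "slice_inf (normal_set a (ev a (lift c)) b g) = (\<lambda>(i,j). of3 i + of3 j * a) ` (UNIV :: (gf3 \<times> gf3) set)"
    (is "?A = ?B")
  proof (intro set_eqI iffI)
    fix x assume "x \<in> ?A"
    then obtain i j l k h where "x = of3 i + of3 j * a + of3 l * b + of3 k * g"
      "of3 h + of3 l * a + of3 k * ev a (lift c) = 0"
      unfolding slice_inf_def mem_Collect_eq normal_set_iff prod.inject by metis
    then show "x \<in> ?B" using z by auto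
  next
    fix x assume "x \<in> ?B"
    then obtain i j where "x = of3 i + of3 j * a" by auto
    then have "(x, 0) = (of3 i + of3 j * a + of3 0 * b + of3 0 * g, of3 0 + of3 0 * a + of3 0 * ev a (lift c))"
      by simp
    then show "x \<in> ?A" unfolding slice_inf_def mem_Collect_eq normal_set_iff by metis
  qed
  moreover have "inj (\<lambda>(i,j). of3 i + of3 j * a)"
  proof (rule injI)
    fix v w :: "gf3 \<times> gf3"
    assume e: "(\<lambda>(i,j). of3 i + of3 j * a) v = (\<lambda>(i,j). of3 i + of3 j * a) w"
    have "of3 i + of3 j * a = ev a (i,j,0,0,0)" for i j by simp
    then show "v = w" using e by (cases v; cases w) (simp add: ev_inject[OF a] del: ev.simps)
  qed
  ultimately show ?thesis by (simp add: card_image card_gf3)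
qed

text \<open>A slice of order 27 needs all three vectors to vanish. The first one puts \<open>m\<close> into the group generated
  by 1 and \<open>a\<close>; the second one puts it into \<open>GF(3)\<close>, because \<open>b\<close> has no coefficient of \<open>a^2\<close>, and makes
  \<open>b\<close> zero; the third one makes \<open>g\<close> a multiple of \<open>c\<close>, hence zero by the choice of \<open>gammas\<close>.\<close>

lemma card_slice_normal_set_less_27:
  assumes a: "(a::'a) \<notin> range of3" and p: "a ^ 5 = ev a p"
    and c: "c \<in> set thirds" and b: "b \<in> set betas" and g: "g \<in> set (gammas c)" and nz: "(b, g) \<noteq> 0"
  shows "card (slice (normal_set a (ev a (lift c)) (ev a (lift b)) (ev a (lift g))) m) < 27"
proof (rule ccontr)
  obtain M where m: "m = ev a M" using bij_ev[OF a] by (metis bij_pointE)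
  assume "\<not> ?thesis"
  then have z: "hi M = 0" "hi (shift p M) - b = 0" "hi (mul p (lift c) M) - g = 0"
    using ker3_UNIV unfolding m card_slice_normal_set[OF a p thirds_nonzero[OF c]] by (meson linorder_not_less)+
  obtain m0 m1 where M: "M = (m0,m1,0,0,0)" using z(1) by (cases M) (auto simp: zero_prod_def)
  obtain b3 b4 where b': "b = (0,b3,b4)" using b by (metis betas_iff prod_cases3)
  obtain p0 p1 p2 p3 p4 where P: "p = (p0,p1,p2,p3,p4)" by (cases p)
  have m1: "m1 = 0" "b = 0" using z(2) by (auto simp: M b' P zero_prod_def)
  have "ev a (mul p (lift c) M) = ev a (scl m0 (lift c))"
    using p by (simp add: del: ev.simps) (simp add: M m1)
  then have "mul p (lift c) M = scl m0 (lift c)" using ev_inject[OF a] by blast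
  then have "g = scl3 m0 c" using z(3) by (simp add: hi_scl hi_lift)
  moreover obtain c2 c3 c4 where C: "c = (c2,c3,c4)" by (cases c)
  ultimately have "m0 = 0 \<or> c = 0" using g c by (auto simp: C gammas_iff thirds_iff split: if_splits)
  then have "g = 0" using \<open>g = scl3 m0 c\<close> by auto
  then show False using nz m1 by (simp add: zero_prod_def)
qed

lemma card_slices_normal_set:
  assumes a: "(a::'a) \<notin> range of3" and p: "a ^ 5 = ev a p" and c: "c \<noteq> 0"
  shows "card {m. card (slice (normal_set a (ev a (lift c)) (ev a (lift b)) (ev a (lift g))) m) = 9}
    = rank1_count p c b g"
proof -
  let ?N = "normal_set a (ev a (lift c)) (ev a (lift b)) (ev a (lift g))"
  let ?R = "{M. rank1 (hi M) (hi (shift p M) - b) (hi (mul p (lift c) M) - g)}"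
  have "card (slice ?N (ev a M)) = 9 \<longleftrightarrow> M \<in> ?R" for M
    unfolding card_slice_normal_set[OF a p c] card_ker3_eq_9 by simp
  then have "{m. card (slice ?N m) = 9} = ev a ` ?R"
    using bij_is_surj[OF bij_ev[OF a]] by (fastforce simp del: ev.simps)
  moreover have "inj_on (ev a) ?R" by (rule inj_on_subset[OF bij_is_inj[OF bij_ev[OF a]]]) simp
  ultimately show ?thesis by (simp only: rank1_count_def card_image)
qed

end

section \<open>The count for every normal form\<close>

text \<open>A necessary condition for rank one that depends on neither \<open>c\<close> nor \<open>g\<close>. It leaves only a small part
  of the 243 elements, and is evaluated once for each pair of \<open>p\<close> and \<open>b\<close>.\<close>

definition near_b :: "q5 \<Rightarrow> q3 \<Rightarrow> q5 \<Rightarrow> bool" where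
  "near_b p b M \<longleftrightarrow> hi M = 0 \<or> par (hi M) (hi (shift p M) - b)"

definition column_triple :: "q5 \<Rightarrow> q3 \<Rightarrow> q3 \<Rightarrow> q5 \<Rightarrow> q3 \<times> q3 \<times> q3" where
  "column_triple p b c M = (hi M, hi (shift p M) - b, hi (mul p (lift c) M))"

fun rank1_columns :: "q3 \<Rightarrow> q3 \<times> q3 \<times> q3 \<Rightarrow> bool" where
  "rank1_columns g (k0, k1, k2) = rank1 k0 k1 (k2 - g)"

lemma rank1_count_code:
  "rank1_count p c b g =
     length (filter (rank1_columns g) (map (column_triple p b c) (filter (near_b p b) enum_class.enum)))"
proof -
  let ?P = "\<lambda>M. rank1 (hi M) (hi (shift p M) - b) (hi (mul p (lift c) M) - g)"
  have "near_b p b M" if "?P M" for M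
    using that by (auto simp: rank1_def near_b_def split: if_splits)
  then have "(\<lambda>M. (rank1_columns g \<circ> column_triple p b c) M \<and> near_b p b M) = ?P"
    by (auto simp: column_triple_def fun_eq_iff simp del: hi.simps)
  then have "length (filter (rank1_columns g) (map (column_triple p b c) (filter (near_b p b) enum_class.enum)))
    = length (filter ?P enum_class.enum)"
    by (simp add: filter_map o_def conj_commute)
  also have "\<dots> = card {M. ?P M}"
    using distinct_length_filter[OF enum_distinct, of ?P] by (simp add: enum_UNIV)
  finally show ?thesis by (simp add: rank1_count_def)
qed

definition admissible_count :: "nat \<Rightarrow> bool" where
  "admissible_count n \<longleftrightarrow> n = 1 \<or> n = 2 \<or> n = 3 \<or> n = 4 \<or> n = 5 \<or> n = 6 \<or> n = 7 \<or> n = 9"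

text \<open>The evaluation is layered so that each layer shares the work that does not depend on the parameters
  of the inner ones. The case \<open>b = 0\<close>, \<open>g = 0\<close> is left out: there the slice at 0 has 27 elements.\<close>

definition check_g where
  "check_g b ks g \<longleftrightarrow> b = 0 \<and> g = 0 \<or> admissible_count (length (filter (rank1_columns g) ks))"

definition check_c where
  "check_c p b Ms c \<longleftrightarrow> list_all (check_g b (map (column_triple p b c) Ms)) (gammas c)"

definition check_M where
  "check_M p b Ms \<longleftrightarrow> list_all (check_c p b Ms) thirds"

definition check_b where
  "check_b p b \<longleftrightarrow> check_M p b (filter (near_b p b) enum_class.enum)"

definition check_p where
  "check_p p \<longleftrightarrow> list_all (check_b p) betas"

lemma check_first_quintic: "check_p (1,1,0,0,0)"
  by code_simp

lemma check_second_quintic: "check_p (1,1,0,0,1)"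
  by code_simp

text \<open>These are the numbers of points of weight 2 beside the one spanned by \<open>v0\<close>, so there is one
  more such point in all.\<close>

lemma admissible_rank1_count:
  assumes "p \<in> set quintics" "c \<in> set thirds" "b \<in> set betas" "g \<in> set (gammas c)" "(b, g) \<noteq> 0"
  shows "rank1_count p c b g \<in> {1,2,3,4,5,6,7,9}"
proof -
  have "check_p p" using assms(1) check_first_quintic check_second_quintic by (auto simp: quintics_def)
  then have "check_g b (map (column_triple p b c) (filter (near_b p b) enum_class.enum)) g"
    using assms(2-4) unfolding check_p_def check_b_def check_M_def check_c_def list_all_iff by blast
  then have "admissible_count (rank1_count p c b g)"
    using assms(5) unfolding check_g_def rank1_count_code by (auto simp: zero_prod_def)
  then show ?thesis by (auto simp: admissible_count_def)
qed

fun realises :: "q5 \<Rightarrow> nat \<times> q3 \<times> q3 \<times> q3 \<Rightarrow> bool" where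
  "realises p (n, c, b, g) \<longleftrightarrow> c \<in> set thirds \<and> b \<in> set betas \<and> g \<in> set (gammas c) \<and> \<not> (b = 0 \<and> g = 0) \<and>
     length (filter (rank1_columns g) (map (column_triple p b c) (filter (near_b p b) enum_class.enum))) = n"

text \<open>Entries \<open>(n, c, b, g)\<close> whose normal form has \<open>n\<close> slices of order nine for both quintics. No triple
  serves both quintics for \<open>n = 9\<close>, so that entry is added separately.\<close>

definition common_witnesses :: "(nat \<times> q3 \<times> q3 \<times> q3) list" where
  "common_witnesses =
     [(1, (1,1,0), (0,1,0), (0,0,-1)), (2, (1,0,0), (0,1,0), (0,0,-1)),
      (3, (1,0,0), (0,0,1), (0,1,1)), (4, (1,0,0), (0,0,1), (0,-1,1)),
      (5, (1,0,0), (0,0,0), (0,0,1)), (6, (1,0,0), (0,0,0), (0,1,0)),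
      (7, (1,1,0), (0,1,-1), (1,0,0))]"

lemma realises_witnesses:
  "list_all (realises (1,1,0,0,0)) ((9, (1,0,0), (0,1,0), (0,0,0)) # common_witnesses)"
  "list_all (realises (1,1,0,0,1)) ((9, (1,0,0), (0,1,0), (0,1,0)) # common_witnesses)"
  by code_simp+

lemma rank1_count_attained:
  assumes "p \<in> set quintics" "n \<in> {1,2,3,4,5,6,7,9}"
  obtains c b g where "c \<in> set thirds" "b \<in> set betas" "g \<in> set (gammas c)" "(b, g) \<noteq> 0"
    "rank1_count p c b g = n"
proof -
  have "n \<in> fst ` set ((9, w) # common_witnesses)" for w
    using assms(2) by (auto simp: common_witnesses_def)
  then obtain c b g where "realises p (n, c, b, g)"
    using assms(1) realises_witnesses by (fastforce simp: quintics_def list_all_iff simp del: realises.simps)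
  then have "c \<in> set thirds \<and> b \<in> set betas \<and> g \<in> set (gammas c) \<and> \<not> (b = 0 \<and> g = 0)
      \<and> rank1_count p c b g = n"
    unfolding realises.simps rank1_count_code .
  moreover from this have "(b, g) \<noteq> 0" by (auto simp: zero_prod_def)
  ultimately show ?thesis using that by blast
qed

section \<open>Points and weights of a linear set\<close>

definition lin :: "'a::field ^ 2 \<Rightarrow> 'a ^ 2 \<Rightarrow> 'a \<times> 'a \<Rightarrow> 'a ^ 2" where
  "lin v0 v1 = (\<lambda>(x, y). x *s v0 + y *s v1)"

lemma lin_simps: "lin v0 v1 (u + w) = lin v0 v1 u + lin v0 v1 w"
  "lin v0 v1 (- u) = - lin v0 v1 u" "lin v0 v1 0 = 0"
  by (cases u; cases w; simp add: lin_def vec.scale_left_distrib zero_prod_def)+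

lemma proj_point_iff: "w \<in> proj_point v \<longleftrightarrow> (\<exists>x. w = x *s v)"
  by (auto simp: proj_point_def vec.span_singleton)

lemma self_mem_proj_point: "v \<in> proj_point v"
  unfolding proj_point_iff by (rule exI[of _ 1]) simp

lemma proj_point_eq:
  assumes "w \<in> proj_point v" "w \<noteq> 0"
  shows "proj_point w = proj_point v"
proof -
  obtain x where x: "w = x *s v" using assms(1) proj_point_iff by blast
  then have "x \<noteq> 0" using assms(2) by auto
  then have "z *s v = (z / x) *s w" for z by (simp add: x)
  then show ?thesis unfolding set_eq_iff proj_point_iff using x by (metis vector_smult_assoc)
qed

lemma mem_L: "P \<in> L U \<longleftrightarrow> (\<exists>v. v \<in> U \<and> v \<noteq> 0 \<and> P = proj_point v)"
  by (auto simp: L_def)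

locale ternary_plane = field_embedding \<phi> + gf243 "TYPE('a)"
  for \<phi> :: "'k::field \<Rightarrow> 'a::field" +
  assumes card_k: "CARD('k) = 3"
begin

lemma k_cases: "c = 0 \<or> c = 1 \<or> c = (- 1 :: 'k)"
  and phi_simps [simp]: "\<phi> 0 = 0" "\<phi> 1 = 1" "\<phi> (- 1) = - 1"
proof -
  have "\<phi> 0 + 0 = \<phi> 0 + \<phi> 0" using add[of 0 0] by simp
  then show 0: "\<phi> 0 = 0" by (metis add_left_cancel)
  show "\<phi> 1 = 1" by (rule one)
  show 1: "\<phi> (- 1) = - 1" using add[of 1 "- 1"] 0 one by (simp add: eq_neg_iff_add_eq_0 add.commute)
  have "(1::'k) \<noteq> - 1" using 1 one one_neq_minus_one by metis
  then have "card {0, 1, - 1 :: 'k} = CARD('k)" using card_k by simp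
  moreover have "finite (UNIV :: 'k set)" using card_k by (metis card.infinite zero_neq_numeral)
  ultimately have "{0, 1, - 1 :: 'k} = UNIV" by (intro card_subset_eq) auto
  then show "c = 0 \<or> c = 1 \<or> c = (- 1 :: 'k)" by auto
qed

sublocale small: vector_space "small_scale \<phi>"
  by (rule vector_space_small_scale) (rule field_embedding_axioms)

lemma finite_plane [simp]: "finite (S :: ('a ^ 2) set)"
proof -
  have "CARD('a ^ 2) = 3 ^ 10" by (simp add: CARD_vec card_field)
  then have "finite (UNIV :: ('a ^ 2) set)" by (metis card.infinite power_eq_0_iff zero_neq_numeral)
  then show ?thesis by (rule rev_finite_subset) simp
qed

lemma triple_plane: "z + z + z = (0 :: 'a ^ 2)"
  by (simp add: vec_eq_iff three)

text \<open>The scalars are 0, 1 and -1, so linearity over the small field is additivity. Accordingly dimensions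
  can be read off from orders.\<close>

lemma small_subspace_iff: "small_subspace \<phi> U \<longleftrightarrow> subgrp U"
proof
  assume "small_subspace \<phi> U"
  then show "subgrp U" unfolding subgrp_def
    using small.subspace_0 small.subspace_add small.subspace_neg by blast
next
  assume U: "subgrp U"
  show "small_subspace \<phi> U"
  proof (rule small.subspaceI)
    fix c v assume "v \<in> U"
    then show "small_scale \<phi> c v \<in> U"
      using k_cases[of c] subgrpD[OF U] by (auto simp: small_scale_def)
  qed (use subgrpD[OF U] in auto)
qed

lemma card_small_span:
  assumes "small.independent B"
  shows "card (small.span B) = 3 ^ card B"
proof -
  have "finite B" by simp
  then show ?thesis using assms
  proof (induction B rule: finite_induct)
    case (insert b B)
    then have ind: "small.independent B" "b \<notin> small.span B"
      using small.independent_insert by metis+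
    have sub: "subgrp (small.span B)" using small.subspace_span small_subspace_iff by blast
    have "small.span (insert b B) = extend (small.span B) b"
    proof (intro set_eqI iffI)
      fix v assume "v \<in> small.span (insert b B)"
      then obtain c where c: "v - small_scale \<phi> c b \<in> small.span B"
        unfolding small.span_insert by blast
      have e: "v = small_scale \<phi> c b + (v - small_scale \<phi> c b)" by simp
      show "v \<in> extend (small.span B) b" using k_cases[of c]
      proof (elim disjE)
        assume "c = 0"
        then show ?thesis using c by (simp add: extend_def)
      next
        assume "c = 1"
        then have "v = b + (v - b)" "v - b \<in> small.span B" using c by simp_all
        then show ?thesis unfolding extend_def by blast
      next
        assume "c = - 1"
        then have "v = - b + (v + b)" "v + b \<in> small.span B" using c by (simp_all add: small_scale_def)
        then show ?thesis unfolding extend_def by blast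
      qed
    next
      fix v assume "v \<in> extend (small.span B) b"
      moreover have "subgrp (small.span (insert b B))" using small.subspace_span small_subspace_iff by blast
      then have "extend (small.span B) b \<subseteq> small.span (insert b B)"
        by (rule extend_subset) (auto intro: small.span_base small.span_mono[THEN subsetD])
      ultimately show "v \<in> small.span (insert b B)" by blast
    qed
    then have "card (small.span (insert b B)) = 3 * 3 ^ card B"
      using card_extend[OF sub _ ind(2) triple_plane] insert.IH[OF ind(1)] by simp
    then show ?case using insert.hyps by simp
  qed simp
qed

lemma card_subspace:
  assumes "subgrp U"
  shows "card U = 3 ^ small_dim \<phi> U"
proof -
  have s: "small_subspace \<phi> U" using assms small_subspace_iff by blast
  obtain B where B: "B \<subseteq> U" "small.independent B" "U \<subseteq> small.span B" "card B = small_dim \<phi> U"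
    by (rule small.basis_exists)
  have "small.span B = U" using B small.span_minimal[OF B(1) s] by blast
  then show ?thesis using card_small_span[OF B(2)] B(4) by simp
qed

lemma subgrp_proj_point: "subgrp (proj_point (v :: 'a ^ 2))"
  unfolding subgrp_def
proof (intro conjI ballI)
  show "0 \<in> proj_point v" unfolding proj_point_iff by (rule exI[of _ 0]) simp
  fix x assume "x \<in> proj_point v"
  then obtain i where i: "x = i *s v" unfolding proj_point_iff by blast
  show "- x \<in> proj_point v" unfolding proj_point_iff by (rule exI[of _ "- i"]) (simp add: i)
  fix y assume "y \<in> proj_point v"
  then obtain j where j: "y = j *s v" unfolding proj_point_iff by blast
  show "x + y \<in> proj_point v" unfolding proj_point_iff
    by (rule exI[of _ "i + j"]) (simp add: i j vec.scale_left_distrib)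
qed

lemma card_weight:
  assumes "subgrp U"
  shows "card (U \<inter> proj_point v) = 3 ^ weight \<phi> U (proj_point v)"
  unfolding weight_def by (intro card_subspace subgrp_Int assms subgrp_proj_point)

lemma weight_eq_iff:
  assumes "subgrp U"
  shows "weight \<phi> U (proj_point v) = i \<longleftrightarrow> card (U \<inter> proj_point v) = 3 ^ i"
  unfolding card_weight[OF assms] by simp

lemma weight_pos:
  assumes "subgrp U" "P \<in> L U"
  shows "0 < weight \<phi> U P"
proof (rule ccontr)
  obtain v where v: "v \<in> U" "v \<noteq> 0" "P = proj_point v" using assms(2) mem_L by blast
  assume "\<not> 0 < weight \<phi> U P"
  then have "card (U \<inter> P) = 1" using card_weight[OF assms(1)] v(3) by simp
  moreover have "v \<in> U \<inter> P" using v self_mem_proj_point by blast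
  moreover have "0 \<in> U \<inter> P" using subgrpD(1) assms(1) subgrp_proj_point v(3) by blast
  ultimately show False using v(2) by (metis card_1_singletonE singletonD)
qed

lemma weight_pos_imp_mem_L:
  assumes "subgrp U" "0 < weight \<phi> U (proj_point v)"
  shows "proj_point v \<in> L U"
proof -
  have "1 < card (U \<inter> proj_point v)" unfolding card_weight[OF assms(1)] using assms(2)
    by (metis one_less_power one_less_numeral_iff semiring_norm(77))
  then have "\<not> U \<inter> proj_point v \<subseteq> {0}" using card_mono[of "{0}" "U \<inter> proj_point v"] by auto
  then obtain w where w: "w \<in> U" "w \<in> proj_point v" "w \<noteq> 0" by auto
  then show ?thesis unfolding mem_L using proj_point_eq[OF w(2,3)] by metis
qed

lemma finite_L [simp]: "finite (L (U :: ('a ^ 2) set))"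
proof -
  have "L U = proj_point ` (U - {0})" by (auto simp: L_def)
  then show ?thesis by simp
qed

lemma distinct_points_meet:
  fixes U :: "('a ^ 2) set"
  assumes "P \<in> L U" "Q \<in> L U" "P \<noteq> Q"
  shows "P \<inter> Q = {0}"
proof -
  obtain v w where vw: "P = proj_point v" "Q = proj_point w" using assms mem_L by metis
  have "u = 0" if "u \<in> P" "u \<in> Q" for u
    using that assms(3) proj_point_eq unfolding vw by metis
  moreover have "0 \<in> P" "0 \<in> Q" using subgrpD(1)[OF subgrp_proj_point] vw by auto
  ultimately show ?thesis by blast
qed

text \<open>The intersections of \<open>U\<close> with two points are independent subgroups of \<open>U\<close>.\<close>

lemma weight_add_le:
  assumes U: "subgrp U" "card U = 3 ^ 5" and P: "P \<in> L U" "Q \<in> L U" "P \<noteq> Q"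
  shows "weight \<phi> U P + weight \<phi> U Q \<le> 5"
proof -
  obtain v w where vw: "P = proj_point v" "Q = proj_point w" using P mem_L by metis
  have "card (U \<inter> P) * card (U \<inter> Q) \<le> card U"
  proof (rule card_subgrp_product_le)
    show "subgrp (U \<inter> P)" "subgrp (U \<inter> Q)" unfolding vw by (intro subgrp_Int U subgrp_proj_point)+
    show "U \<inter> P \<inter> (U \<inter> Q) = {0}" using distinct_points_meet[OF P] subgrpD(1)[OF U(1)] by auto
  qed (use subgrpD(2)[OF U(1)] in auto)
  then have "(3::nat) ^ (weight \<phi> U P + weight \<phi> U Q) \<le> 3 ^ 5"
    using card_weight[OF U(1)] U(2) unfolding vw by (simp add: power_add)
  then show ?thesis by (simp only: power_increasing_iff one_less_numeral_iff semiring_norm)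
qed

lemma partition_by_points:
  assumes "subgrp U"
  shows "(\<Sum>P\<in>L U. 3 ^ weight \<phi> U P - 1) = card U - 1"
proof -
  have "U - {0} = (\<Union>P\<in>L U. U \<inter> P - {0})"
  proof
    show "U - {0} \<subseteq> (\<Union>P\<in>L U. U \<inter> P - {0})"
    proof
      fix v assume v: "v \<in> U - {0}"
      then have "proj_point v \<in> L U" unfolding mem_L by blast
      then show "v \<in> (\<Union>P\<in>L U. U \<inter> P - {0})" using v self_mem_proj_point by blast
    qed
  qed auto
  then have "card (U - {0}) = card (\<Union>P\<in>L U. U \<inter> P - {0})" by (rule arg_cong)
  also have "\<dots> = (\<Sum>P\<in>L U. card (U \<inter> P - {0}))"
    by (rule card_UN_disjoint) (use distinct_points_meet in auto)
  also have "\<dots> = (\<Sum>P\<in>L U. 3 ^ weight \<phi> U P - 1)"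
  proof (rule sum.cong)
    fix P assume "P \<in> L U"
    then obtain v where "P = proj_point v" using mem_L by blast
    moreover have "0 \<in> U \<inter> P" using subgrpD(1) assms subgrp_proj_point calculation by blast
    ultimately show "card (U \<inter> P - {0}) = 3 ^ weight \<phi> U P - 1" using card_weight[OF assms] by simp
  qed simp
  finally show ?thesis using subgrpD(1)[OF assms] by simp
qed

lemma sum_by_weight:
  assumes "subgrp U" "\<forall>P \<in> L U. weight \<phi> U P \<le> 4"
  shows "(\<Sum>P\<in>L U. f (weight \<phi> U P)) = (\<Sum>i\<in>{1..4}. card (points_of_weight \<phi> U i) * f i :: nat)"
proof -
  have "weight \<phi> U ` L U \<subseteq> {1..4}" using assms weight_pos by fastforce
  from sum.group[OF finite_L _ this, of "\<lambda>P. f (weight \<phi> U P)"]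
  have "(\<Sum>P\<in>L U. f (weight \<phi> U P)) = (\<Sum>i\<in>{1..4}. \<Sum>P\<in>{P \<in> L U. weight \<phi> U P = i}. f (weight \<phi> U P))"
    by simp
  also have "\<dots> = (\<Sum>i\<in>{1..4}. card (points_of_weight \<phi> U i) * f i)"
    unfolding points_of_weight_def by (intro sum.cong refl) simp
  finally show ?thesis .
qed

text \<open>The first equation counts the nonzero vectors of \<open>U\<close> up to sign: a point of weight \<open>i\<close> carries
  \<open>(3 ^ i - 1) / 2\<close> of them.\<close>

lemma weight_equations:
  assumes "subgrp U" "card U = 3 ^ 5" "\<forall>P \<in> L U. weight \<phi> U P \<le> 4"
  defines "n \<equiv> \<lambda>i. card (points_of_weight \<phi> U i)"
  shows "n 1 + 4 * n 2 + 13 * n 3 + 40 * n 4 = 121" "card (L U) = n 1 + n 2 + n 3 + n 4"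
proof -
  have i: "{1..4} = {1,2,3,4::nat}" by auto
  show "n 1 + 4 * n 2 + 13 * n 3 + 40 * n 4 = 121"
    using sum_by_weight[OF assms(1,3), of "\<lambda>i. 3 ^ i - 1"] partition_by_points[OF assms(1)] assms(2)
    unfolding i n_def by simp
  show "card (L U) = n 1 + n 2 + n 3 + n 4"
    using sum_by_weight[OF assms(1,3), of "\<lambda>i. 1"] unfolding i n_def by simp
qed

lemma weight_le_4:
  assumes U: "subgrp U" "card U = 3 ^ 5" "1 < card (L U)" and P: "P \<in> L U"
  shows "weight \<phi> U P \<le> 4"
proof -
  have "L U \<noteq> {P}" using U(3) by auto
  then obtain Q where "Q \<in> L U" "Q \<noteq> P" using P by blast
  then show ?thesis using weight_add_le[OF U(1,2) P, of Q] weight_pos[OF U(1), of Q] by auto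
qed

end

section \<open>From points to slices\<close>

context ternary_plane
begin

lemma bij_lin:
  assumes v: "v0 \<noteq> 0" "v1 \<notin> proj_point (v0 :: 'a ^ 2)"
  shows "bij (lin v0 v1)"
proof -
  have inj: "inj (lin v0 v1)"
  proof (rule injI)
    fix u w :: "'a \<times> 'a" assume e: "lin v0 v1 u = lin v0 v1 w"
    obtain x y where u: "u = (x, y)" by (cases u)
    obtain x' y' where w: "w = (x', y')" by (cases w)
    have d: "(y - y') *s v1 = (x' - x) *s v0"
      using e unfolding lin_def u w prod.case
      by (simp add: vec.scale_left_diff_distrib algebra_simps)
    have "y = y'"
    proof (rule ccontr)
      assume "y \<noteq> y'"
      then have "v1 = (inverse (y - y') * (y - y')) *s v1" by simp
      also have "\<dots> = inverse (y - y') *s ((y - y') *s v1)" by (rule vector_smult_assoc[symmetric])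
      also have "\<dots> = (inverse (y - y') * (x' - x)) *s v0" unfolding d by (rule vector_smult_assoc)
      finally have "v1 = (inverse (y - y') * (x' - x)) *s v0" .
      then show False using v(2) proj_point_iff by blast
    qed
    then have "(x' - x) *s v0 = 0" using d by simp
    then have "x = x'" using v(1) by (simp add: vec.scale_eq_0_iff)
    then show "u = w" using \<open>y = y'\<close> u w by simp
  qed
  have "card (range (lin v0 v1)) = CARD('a \<times> 'a)" by (rule card_image[OF inj])
  then have "card (range (lin v0 v1)) = CARD('a ^ 2)" by (simp add: card_field)
  then have "surj (lin v0 v1)" by (intro card_eq_UNIV_imp_eq_UNIV) simp_all
  then show ?thesis using inj by (simp add: bij_def)
qed

lemma subgrp_vimage_lin:
  assumes "subgrp U"
  shows "subgrp (lin v0 v1 -` U)"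
  unfolding subgrp_def by (simp add: lin_simps subgrpD[OF assms])

lemma lin_axis: "lin v0 v1 (x, 0) = x *s v0" "lin v0 v1 (m * y, y) = y *s (m *s v0 + v1)"
  by (simp_all add: lin_def vec.scale_right_distrib mult.commute)

lemma card_Int_proj_point:
  assumes "(v :: 'a ^ 2) \<noteq> 0"
  shows "card (U \<inter> proj_point v) = card {x. x *s v \<in> U}"
proof -
  have "U \<inter> proj_point v = (\<lambda>x. x *s v) ` {x. x *s v \<in> U}"
    by (auto simp: proj_point_iff)
  moreover have "inj (\<lambda>x. x *s v)" using assms by (auto simp: inj_def vec.scale_cancel_right)
  ultimately show ?thesis by (metis card_image inj_on_subset subset_UNIV)
qed

lemma
  assumes v: "v0 \<noteq> 0" "v1 \<notin> proj_point (v0 :: 'a ^ 2)"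
  shows affine_point_neq: "proj_point (m *s v0 + v1) \<noteq> proj_point v0"
    and affine_point_inj: "proj_point (m *s v0 + v1) = proj_point (m' *s v0 + v1) \<Longrightarrow> m = m'"
    and point_cases: "w \<noteq> 0 \<Longrightarrow> proj_point w = proj_point v0 \<or> (\<exists>m. proj_point w = proj_point (m *s v0 + v1))"
    and card_Int_base_point: "card (U \<inter> proj_point v0) = card (slice_inf (lin v0 v1 -` U))"
    and card_Int_affine_point: "card (U \<inter> proj_point (m *s v0 + v1)) = card (slice (lin v0 v1 -` U) m)"
proof -
  note bij = bij_lin[OF v]
  have inj: "lin v0 v1 u = lin v0 v1 w \<longleftrightarrow> u = w" for u w using bij by (metis bij_def inj_eq)
  have L: "m *s v0 + v1 = lin v0 v1 (m, 1)" for m by (simp add: lin_def)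
  have V: "x *s v0 = lin v0 v1 (x, 0)" for x by (simp add: lin_def)
  have S: "z *s lin v0 v1 (x, y) = lin v0 v1 (z * x, z * y)" for x y z
    by (simp add: lin_def vec.scale_right_distrib)
  have nz: "m *s v0 + v1 \<noteq> 0" for m
    unfolding L lin_simps(3)[of v0 v1, symmetric] inj by (simp add: zero_prod_def)
  show "proj_point (m *s v0 + v1) \<noteq> proj_point v0"
  proof
    assume "proj_point (m *s v0 + v1) = proj_point v0"
    then have "m *s v0 + v1 \<in> proj_point v0" using self_mem_proj_point[of "m *s v0 + v1"] by simp
    then obtain x where "m *s v0 + v1 = x *s v0" unfolding proj_point_iff by blast
    then have "lin v0 v1 (m, 1) = lin v0 v1 (x, 0)" by (simp add: lin_def)
    then show False unfolding inj by simp
  qed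
  show "m = m'" if "proj_point (m *s v0 + v1) = proj_point (m' *s v0 + v1)"
  proof -
    have "m *s v0 + v1 \<in> proj_point (m' *s v0 + v1)" using self_mem_proj_point[of "m *s v0 + v1"] that by simp
    then obtain x where "m *s v0 + v1 = x *s (m' *s v0 + v1)" unfolding proj_point_iff by blast
    then show ?thesis unfolding L S inj by simp
  qed
  show "proj_point w = proj_point v0 \<or> (\<exists>m. proj_point w = proj_point (m *s v0 + v1))" if "w \<noteq> 0"
  proof -
    obtain x y where w: "w = lin v0 v1 (x, y)" using bij by (metis bij_pointE surj_pair)
    show ?thesis
    proof (cases "y = 0")
      case True
      then have "w \<in> proj_point v0" unfolding proj_point_iff w lin_def by auto
      then show ?thesis using proj_point_eq that by blast
    next
      case False
      then have "w = y *s ((x / y) *s v0 + v1)" unfolding w L S by simp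
      then have "w \<in> proj_point ((x / y) *s v0 + v1)" unfolding proj_point_iff by blast
      then show ?thesis using proj_point_eq that by blast
    qed
  qed
  show "card (U \<inter> proj_point v0) = card (slice_inf (lin v0 v1 -` U))"
    unfolding card_Int_proj_point[OF v(1)] slice_inf_def by (simp add: lin_axis)
  show "card (U \<inter> proj_point (m *s v0 + v1)) = card (slice (lin v0 v1 -` U) m)"
    unfolding card_Int_proj_point[OF nz] slice_def by (simp add: lin_axis)
qed

lemma card_points_off_base:
  assumes U: "subgrp U" and v: "v0 \<noteq> 0" "v1 \<notin> proj_point (v0 :: 'a ^ 2)" and i: "0 < i"
  shows "card (points_of_weight \<phi> U i - {proj_point v0}) = card {m. card (slice (lin v0 v1 -` U) m) = 3 ^ i}"
proof -
  have W: "weight \<phi> U (proj_point (m *s v0 + v1)) = i \<longleftrightarrow> card (slice (lin v0 v1 -` U) m) = 3 ^ i" for m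
    unfolding weight_eq_iff[OF U] card_Int_affine_point[OF v] ..
  have "points_of_weight \<phi> U i - {proj_point v0} =
    (\<lambda>m. proj_point (m *s v0 + v1)) ` {m. card (slice (lin v0 v1 -` U) m) = 3 ^ i}" (is "?A = ?f ` ?B")
  proof (intro set_eqI iffI)
    fix P assume "P \<in> ?A"
    then have P: "P \<in> L U" "weight \<phi> U P = i" "P \<noteq> proj_point v0" by (auto simp: points_of_weight_def)
    then obtain m where "P = proj_point (m *s v0 + v1)" using point_cases[OF v] mem_L by metis
    then show "P \<in> ?f ` ?B" using P(2) W by blast
  next
    fix P assume "P \<in> ?f ` ?B"
    then obtain m where m: "P = proj_point (m *s v0 + v1)" "weight \<phi> U P = i" using W by blast
    then have "P \<in> L U" using weight_pos_imp_mem_L[OF U] i by metis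
    then show "P \<in> ?A" using m affine_point_neq[OF v] by (simp add: points_of_weight_def)
  qed
  moreover have "inj ?f" using affine_point_inj[OF v] by (rule injI)
  ultimately show ?thesis by (metis card_image inj_on_subset subset_UNIV)
qed

lemma vector_off_point:
  obtains v1 where "v1 \<notin> proj_point (v0 :: 'a ^ 2)"
proof -
  have "card (proj_point v0) \<le> CARD('a)"
    unfolding proj_point_def vec.span_singleton by (rule card_image_le) simp
  then have "proj_point v0 \<noteq> UNIV" using card_field by auto
  then show ?thesis using that by blast
qed

lemma card_vimage_lin:
  assumes v: "v0 \<noteq> 0" "v1 \<notin> proj_point (v0 :: 'a ^ 2)"
  shows "card (lin v0 v1 -` U) = card U"
  using bij_lin[OF v] by (intro card_vimage_inj) (auto simp: bij_def)

text \<open>Every point of weight 2 other than \<open>P\<close> is a slice of order nine, and these were counted for all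
  normal forms. The omitted forms with \<open>b = 0\<close> and \<open>g = 0\<close> cannot occur here, because they contain a point
  of weight 3.\<close>

lemma count_weight_2:
  assumes U: "subgrp U" "card U = 3 ^ 5" and w: "\<forall>P \<in> L U. weight \<phi> U P \<le> 2"
    and P: "P \<in> L U" "weight \<phi> U P = 2"
  shows "card (points_of_weight \<phi> U 2) \<in> {2,3,4,5,6,7,8,10}"
proof -
  obtain v0 where v0: "v0 \<noteq> 0" "P = proj_point v0" using P(1) mem_L by blast
  obtain v1 where v1: "v1 \<notin> proj_point v0" by (rule vector_off_point)
  define X where "X = lin v0 v1 -` U"
  have X: "subgrp X" "card X = 3 ^ 5" "card (slice_inf X) = 9"
    using subgrp_vimage_lin[OF U(1)] card_vimage_lin[OF v0(1) v1] U(2)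
      card_Int_base_point[OF v0(1) v1, of U] card_weight[OF U(1), of v0] P(2) v0(2)
    unfolding X_def by simp_all
  obtain a p c b g where a: "a \<notin> range of3" and p: "p \<in> set quintics" "a ^ 5 = ev a p"
    and cbg: "c \<in> set thirds" "b \<in> set betas" "g \<in> set (gammas c)"
    and N: "triangular_equiv X (normal_set a (ev a (lift c)) (ev a (lift b)) (ev a (lift g)))"
    by (rule normal_form[OF X])
  note slices = triangular_equiv_card_slices[OF N]
  have "(b, g) \<noteq> 0"
  proof
    assume "(b, g) = 0"
    then have bg: "b = 0" "g = 0" by (simp_all add: zero_prod_def)
    have all_ker: "card (ker3 0 0 0) = 27"
    proof -
      have "ker3 0 0 0 = UNIV" by (auto simp: ker3_def)
      then show ?thesis by (simp add: card_gf3)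
    qed
    have h0: "hi 0 = 0" by (simp add: zero_prod_def)
    have "shift p 0 = 0" by (cases p) (simp add: zero_prod_def)
    moreover have "mul p (lift c) 0 = 0" using ev_eq_0[OF a, of "mul p (lift c) 0"] p(2) by (simp del: ev.simps)
    ultimately have "card (slice (normal_set a (ev a (lift c)) (ev a (lift b)) (ev a (lift g))) (ev a 0)) = 27"
      unfolding card_slice_normal_set[OF a p(2) thirds_nonzero[OF cbg(1)]] bg
      by (simp add: h0 all_ker del: hi.simps)
    then have "card {m. card (slice X m) = 27} \<noteq> 0" unfolding slices by (auto simp del: ev.simps)
    then obtain m where "card (slice X m) = 3 ^ 3" by (auto simp: card_eq_0_iff)
    then have "weight \<phi> U (proj_point (m *s v0 + v1)) = 3"
      unfolding weight_eq_iff[OF U(1)] card_Int_affine_point[OF v0(1) v1] X_def .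
    moreover from this have "proj_point (m *s v0 + v1) \<in> L U"
      by (intro weight_pos_imp_mem_L[OF U(1)]) simp
    ultimately show False using w by fastforce
  qed
  then have "rank1_count p c b g \<in> {1,2,3,4,5,6,7,9}"
    by (rule admissible_rank1_count[OF p(1) cbg])
  moreover have "card (points_of_weight \<phi> U 2 - {P}) = rank1_count p c b g"
    using card_points_off_base[OF U(1) v0(1) v1, of 2]
      slices[of 9] card_slices_normal_set[OF a p(2) thirds_nonzero[OF cbg(1)]]
    unfolding v0(2) X_def by simp
  moreover have "P \<in> points_of_weight \<phi> U 2" "finite (points_of_weight \<phi> U 2)"
    using P by (auto simp: points_of_weight_def)
  then have "card (points_of_weight \<phi> U 2) = Suc (card (points_of_weight \<phi> U 2 - {P}))"
    by (metis card.remove)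
  ultimately show ?thesis by auto
qed

text \<open>With \<open>v0\<close> on \<open>P\<close> and \<open>v1 \<in> U\<close> on a point of weight 2, the orders 27 and 9 force \<open>X = A \<times> B\<close>. A slice then is
  \<open>{y \<in> B. m y \<in> A}\<close>, and since \<open>B\<close> is generated by 1 and \<open>b\<close>, it has nine elements exactly if \<open>m\<close> and \<open>b m\<close>
  lie in \<open>A\<close>. The group \<open>D\<close> of these \<open>m\<close> is neither trivial nor all of \<open>A\<close>.\<close>

lemma count_weight_2_beside_weight_3:
  assumes U: "subgrp U" "card U = 3 ^ 5" and P: "P \<in> L U" "weight \<phi> U P = 3"
  shows "card (points_of_weight \<phi> U 2) \<in> {0, 3, 9}"
proof (cases "points_of_weight \<phi> U 2 = {}")
  case False
  then obtain Q where Q: "Q \<in> L U" "weight \<phi> U Q = 2" by (auto simp: points_of_weight_def)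
  obtain v0 where v0: "v0 \<noteq> 0" "P = proj_point v0" using P(1) mem_L by blast
  obtain v1 where v1: "v1 \<in> U" "v1 \<noteq> 0" "Q = proj_point v1" using Q(1) mem_L by blast
  have "v1 \<notin> proj_point v0" using proj_point_eq v1(2,3) v0(2) P Q by fastforce
  note v = v0(1) this
  define X where "X = lin v0 v1 -` U"
  have X: "subgrp X" "card X = 3 ^ 5" 
    using subgrp_vimage_lin[OF U(1)] card_vimage_lin[OF v] U(2) unfolding X_def by simp_all
  define A B where "A = slice_inf X" and "B = slice X 0"
  have cA: "card A = 27" using card_Int_base_point[OF v, of U] card_weight[OF U(1), of v0] P(2) v0(2)
    unfolding X_def A_def by simp
  have cB: "card B = 9" using card_Int_affine_point[OF v, of U 0] card_weight[OF U(1), of v1] Q(2) v1(3)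
    unfolding X_def B_def by simp
  have sA: "subgrp A" unfolding A_def slice_inf_def subgrp_def
    using subgrpD[OF X(1)] by (force simp: zero_prod_def)
  have "A \<times> B \<subseteq> X"
  proof clarify
    fix x y assume "x \<in> A" "y \<in> B"
    then have "(x, 0) + (0, y) \<in> X" unfolding A_def B_def slice_inf_def slice_def
      by (intro subgrpD(2)[OF X(1)]) auto
    then show "(x, y) \<in> X" by simp
  qed
  moreover have "card (A \<times> B) = card X" by (simp add: card_cartesian_product cA cB X(2))
  moreover have "finite X" using X(2) by (metis card.infinite power_eq_0_iff zero_neq_numeral)
  ultimately have AB: "X = A \<times> B" using card_subset_eq by metis
  have one: "1 \<in> B" unfolding B_def slice_def X_def using v1(1) by (simp add: lin_def)
  have "\<not> B \<subseteq> range of3"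
  proof
    assume "B \<subseteq> range of3"
    then have "card B \<le> card (range (of3 :: gf3 \<Rightarrow> 'a))" by (intro card_mono) auto
    also have "\<dots> \<le> CARD(gf3)" by (rule card_image_le) simp
    finally show False using cB card_gf3 by simp
  qed
  then obtain b where b: "b \<in> B" "b \<notin> range of3" by blast
  have b0: "b \<noteq> 0" using b(2) by (metis of3.simps(1) rangeI)
  define D where "D = {m \<in> A. b * m \<in> A}"
  have "card (slice X m) = 9 \<longleftrightarrow> m \<in> D" for m
  proof
    assume "card (slice X m) = 9"
    moreover have "slice X m \<subseteq> B" unfolding slice_def AB by auto
    ultimately have "slice X m = B" using cB by (intro card_subset_eq) auto
    then have "1 \<in> slice X m" "b \<in> slice X m" using one b by auto
    then show "m \<in> D" unfolding slice_def AB D_def by (simp add: mult.commute)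
  next
    assume m: "m \<in> D"
    have B: "extend (extend {0} 1) b \<subseteq> slice X m"
    proof -
      have sS: "subgrp (slice X m)"
        using subgrpD[OF X(1)] unfolding slice_def subgrp_def by (force simp: zero_prod_def algebra_simps)
      have "1 \<in> slice X m" "b \<in> slice X m" using m one b unfolding slice_def AB D_def
        by (simp_all add: mult.commute)
      then show ?thesis using subgrpD(1)[OF sS] by (intro extend_subset[OF sS]) auto
    qed
    have s0: "subgrp {0::'a}" by (simp add: subgrp_def)
    have s1: "subgrp (extend {0::'a} 1)" "card (extend {0::'a} 1) = 3"
      using subgrp_extend[OF s0 _ _ triple, of 1] card_extend[OF s0 _ _ triple, of 1] by simp_all
    have "extend {0::'a} 1 = {0, 1, - 1}" unfolding extend_def by auto
    then have "b \<notin> extend {0} 1" using b(2) by (metis insertE empty_iff of3.simps rangeI)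
    then have "card (extend (extend {0} 1) b) = 9" using card_extend[OF s1(1) _ _ triple, of b] s1(2) by simp
    then have "9 \<le> card (slice X m)" using B by (metis card_mono finite_field(2))
    moreover have "slice X m \<subseteq> B" unfolding slice_def AB by auto
    then have "card (slice X m) \<le> 9" using cB by (metis card_mono finite_field(2))
    ultimately show "card (slice X m) = 9" by simp
  qed
  then have D: "{m. card (slice X m) = 3 ^ 2} = D" by auto
  have "P \<notin> points_of_weight \<phi> U 2" using P(2) by (simp add: points_of_weight_def)
  then have n: "card (points_of_weight \<phi> U 2) = card D"
    using card_points_off_base[OF U(1) v, of 2] D unfolding v0(2) X_def by simp
  have sD: "subgrp D" using subgrpD[OF sA] unfolding D_def subgrp_def by (auto simp: algebra_simps)
  obtain k where k: "card D = 3 ^ k" using card_subgrp_power[OF sD _ triple] by auto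
  obtain z where "z \<noteq> 0" "z \<in> A" "b * z \<in> A" by (rule large_subgrp_meets[OF sA _ b0]) (use cA in simp)
  then have "z \<in> D" "0 \<in> D" using subgrpD(1)[OF sD] by (auto simp: D_def)
  then have "k \<noteq> 0" using k \<open>z \<noteq> 0\<close> by (metis card_1_singletonE power_0 singletonD)
  have "D \<noteq> A"
  proof
    assume "D = A"
    then have "(*) b ` A \<subseteq> A" unfolding D_def by blast
    moreover have "A \<noteq> {0}" "A \<noteq> UNIV" using cA card_field by auto
    ultimately show False using stable_subgrp[OF sA] b(2) by blast
  qed
  moreover have "D \<subseteq> A" by (auto simp: D_def)
  ultimately have "card D < card A" by (intro psubset_card_mono) auto
  then have "(3::nat) ^ k < 3 ^ 3" using k cA by simp
  then have "k < 3" by (metis nat_power_less_imp_less zero_less_numeral)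
  then have "k = 1 \<or> k = 2" using \<open>k \<noteq> 0\<close> by auto
  then show ?thesis using n k by auto
qed simp

lemma realise_coordinates:
  fixes Y :: "('a \<times> 'a) set"
  assumes Y: "subgrp Y" "card Y = 3 ^ 5"
  obtains U v0 v1 where "subgrp U" "card U = 3 ^ 5" "v0 \<noteq> 0" "v1 \<notin> proj_point v0" "lin v0 v1 -` U = Y"
proof -
  obtain v0 :: "'a ^ 2" where v0: "v0 \<noteq> 0"
    by (rule that[of "axis 1 1"]) (simp add: axis_eq_0_iff)
  obtain v1 where v1: "v1 \<notin> proj_point v0" by (rule vector_off_point)
  note bij = bij_lin[OF v0 v1]
  have 1: "lin v0 v1 -` (lin v0 v1 ` Y) = Y" using bij by (simp add: bij_def inj_vimage_image_eq)
  have "card (lin v0 v1 ` Y) = card Y"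
    using bij by (intro card_image) (metis bij_def inj_on_subset subset_UNIV)
  moreover have "subgrp (lin v0 v1 ` Y)" by (rule subgrp_image[OF lin_simps(1) Y(1)])
  ultimately show ?thesis using that[OF _ _ v0 v1 1] Y(2) by simp
qed

text \<open>A point of weight 4 or 3 excludes a second one and limits all other weights to 1 or 2, respectively;
  the remaining numbers follow from \<open>weight_equations\<close>.\<close>

lemma weight_cases:
  assumes U: "subgrp U" "card U = 3 ^ 5" "1 < card (L U)"
  defines "n \<equiv> \<lambda>i. card (points_of_weight \<phi> U i)"
  obtains
    (four) P where "P \<in> L U" "weight \<phi> U P = 4" "\<And>Q. Q \<in> L U \<Longrightarrow> Q \<noteq> P \<Longrightarrow> weight \<phi> U Q = 1"
      "n 4 = 1" "n 3 = 0" "n 2 = 0" "n 1 = 81" "card (L U) = 82"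
  | (three) P where "P \<in> L U" "weight \<phi> U P = 3" "\<And>Q. Q \<in> L U \<Longrightarrow> Q \<noteq> P \<Longrightarrow> weight \<phi> U Q \<in> {1, 2}"
      "n 4 = 0" "n 3 = 1" "card (L U) = 109 - 3 * n 2"
  | (two) "\<And>P. P \<in> L U \<Longrightarrow> weight \<phi> U P \<in> {1, 2}" "n 4 = 0" "n 3 = 0" "n 1 + 4 * n 2 = 121" "card (L U) = 121 - 3 * n 2"
proof -
  have le4: "\<forall>P \<in> L U. weight \<phi> U P \<le> 4" using weight_le_4[OF U] by blast
  have eq: "n 1 + 4 * n 2 + 13 * n 3 + 40 * n 4 = 121" "card (L U) = n 1 + n 2 + n 3 + n 4"
    unfolding n_def by (rule weight_equations[OF U(1,2) le4])+
  have pos: "0 < weight \<phi> U P" if "P \<in> L U" for P using weight_pos[OF U(1) that] .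
  have sum5: "weight \<phi> U P + weight \<phi> U Q \<le> 5" if "P \<in> L U" "Q \<in> L U" "P \<noteq> Q" for P Q
    using weight_add_le[OF U(1,2) that] .
  have n0: "n i = 0" if "\<And>P. P \<in> L U \<Longrightarrow> weight \<phi> U P \<noteq> i" for i
  proof -
    have "points_of_weight \<phi> U i = {}" using that by (auto simp: points_of_weight_def)
    then show ?thesis by (simp add: n_def)
  qed
  have n1: "n i = 1" if "P \<in> L U" "weight \<phi> U P = i" "\<And>Q. Q \<in> L U \<Longrightarrow> Q \<noteq> P \<Longrightarrow> weight \<phi> U Q \<noteq> i" for i P
  proof -
    have "points_of_weight \<phi> U i = {P}" using that by (auto simp: points_of_weight_def)
    then show ?thesis by (simp add: n_def)
  qed
  consider (a) P where "P \<in> L U" "weight \<phi> U P = 4" | (b) P where "P \<in> L U" "weight \<phi> U P = 3"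
    | (c) "\<And>P. P \<in> L U \<Longrightarrow> weight \<phi> U P \<noteq> 4 \<and> weight \<phi> U P \<noteq> 3" by blast
  then show ?thesis
  proof cases
    case (a P)
    have o: "weight \<phi> U Q = 1" if "Q \<in> L U" "Q \<noteq> P" for Q
      using sum5[OF a(1) that(1)] that pos[OF that(1)] a(2) by auto
    have "n 4 = 1" using n1[OF a(1,2)] o by fastforce
    moreover have "n 3 = 0" "n 2 = 0" using n0 o a(2) by (metis numeral_eq_iff numeral_eq_one_iff semiring_norm(84-90))+
    ultimately show ?thesis using four[OF a o] eq by simp
  next
    case (b P)
    have o: "weight \<phi> U Q \<in> {1, 2}" if "Q \<in> L U" "Q \<noteq> P" for Q
      using sum5[OF b(1) that(1)] that pos[OF that(1)] b(2) by auto
    have "n 3 = 1" using n1[OF b(1,2)] o by fastforce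
    moreover have "n 4 = 0" using n0[of 4] o b(2) by fastforce
    ultimately show ?thesis using three[OF b o] eq by simp
  next
    case c
    have o: "weight \<phi> U Q \<in> {1, 2}" if "Q \<in> L U" for Q
      using c[OF that] le4 pos[OF that] that by fastforce
    have "n 4 = 0" "n 3 = 0" using n0 c by auto
    then show ?thesis using two[OF o] eq by simp
  qed
qed

lemma weight_distribution:
  assumes U: "subgrp U" "card U = 3 ^ 5" "1 < card (L U)"
  defines "n \<equiv> \<lambda>i. card (points_of_weight \<phi> U i)"
  shows "(n 4 = 1 \<and> n 1 = 81 \<and> (\<forall>P \<in> L U. weight \<phi> U P \<in> {4, 1}) \<and> club \<phi> 4 U \<and> card (L U) = 82)
    \<or> (n 3 = 1 \<and> n 2 \<in> {0, 3, 9} \<and> (\<forall>P \<in> L U. weight \<phi> U P \<in> {3, 2, 1}) \<and> card (L U) = 109 - 3 * n 2)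
    \<or> (n 2 \<in> {2,3,4,5,6,7,8,10} \<and> (\<forall>P \<in> L U. weight \<phi> U P \<in> {2, 1}) \<and> card (L U) = 121 - 3 * n 2)
    \<or> (n 1 = 121 \<and> (\<forall>P \<in> L U. weight \<phi> U P = 1) \<and> card (L U) = 121)"
  using U
proof (cases rule: weight_cases)
  case (four P)
  have "club \<phi> 4 U" unfolding club_def small_subspace_iff using U(1) four(1-3) by (intro conjI bexI[of _ P]) auto
  then show ?thesis using four(2-8) unfolding n_def by (intro disjI1) auto
next
  case (three P)
  have "n 2 \<in> {0, 3, 9}" unfolding n_def by (rule count_weight_2_beside_weight_3[OF U(1,2) three(1,2)])
  then show ?thesis using three(2-6) unfolding n_def by (intro disjI2 disjI1) auto
next
  case two
  have w: "\<forall>P \<in> L U. weight \<phi> U P \<le> 2" using two(1) by fastforce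
  show ?thesis
  proof (cases "n 2 = 0")
    case True
    then have "points_of_weight \<phi> U 2 = {}" unfolding n_def by (simp add: points_of_weight_def)
    then have "\<forall>P \<in> L U. weight \<phi> U P = 1" using two(1) unfolding points_of_weight_def by blast
    then show ?thesis using two(4,5) True unfolding n_def by simp
  next
    case False
    then have "points_of_weight \<phi> U 2 \<noteq> {}" unfolding n_def by auto
    then obtain P where "P \<in> L U" "weight \<phi> U P = 2" by (auto simp: points_of_weight_def)
    then have "n 2 \<in> {2,3,4,5,6,7,8,10}" unfolding n_def by (rule count_weight_2[OF U(1,2) w])
    then show ?thesis using two(1,5) unfolding n_def by (intro disjI2 disjI1) auto
  qed
qed

end

section \<open>Linear sets of every size\<close>

context ternary_plane
begin

lemma subgrp_normal_set: "subgrp (normal_set a c b (g :: 'a))"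
proof -
  have "subgrp (range (\<lambda>(i,j,h,l,k). (of3 i + of3 j * a + of3 l * b + of3 k * g, of3 h + of3 l * a + of3 k * c)))"
    by (rule subgrp_range) (auto simp: algebra_simps)
  then show ?thesis unfolding normal_set_def .
qed

lemma mem_points_of_weight:
  assumes U: "subgrp U" and i: "0 < i" and c: "card (U \<inter> proj_point v) = 3 ^ i"
  shows "proj_point v \<in> points_of_weight \<phi> U i"
  using c i weight_pos_imp_mem_L[OF U, of v] unfolding points_of_weight_def weight_eq_iff[OF U, symmetric] by auto

lemma point_slices:
  assumes U: "subgrp U" and v: "v0 \<noteq> 0" "v1 \<notin> proj_point (v0 :: 'a ^ 2)" and P: "P \<in> L U"
  obtains (base) "P = proj_point v0" "3 ^ weight \<phi> U P = card (slice_inf (lin v0 v1 -` U))"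
    | (affine) m where "P = proj_point (m *s v0 + v1)" "3 ^ weight \<phi> U P = card (slice (lin v0 v1 -` U) m)"
proof -
  obtain w where w: "w \<noteq> 0" "P = proj_point w" using P mem_L by blast
  from point_cases[OF v w(1)] show ?thesis
  proof
    assume "proj_point w = proj_point v0"
    then show ?thesis using base card_Int_base_point[OF v, of U] card_weight[OF U, of v0] w by simp
  next
    assume "\<exists>m. proj_point w = proj_point (m *s v0 + v1)"
    then obtain m where "proj_point w = proj_point (m *s v0 + v1)" by blast
    then show ?thesis using affine[of m] card_Int_affine_point[OF v, of U m] card_weight[OF U, of "m *s v0 + v1"] w by simp
  qed
qed

lemma quintic_element_exists:
  obtains a :: 'a and p where "a \<notin> range of3" "p \<in> set quintics" "a ^ 5 = ev a p"
proof -
  have "card (range (of3 :: gf3 \<Rightarrow> 'a)) \<le> CARD(gf3)" by (rule card_image_le) simp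
  then have "range (of3 :: gf3 \<Rightarrow> 'a) \<noteq> UNIV" using card_field by (auto simp: card_gf3)
  then obtain b :: 'a where b: "b \<notin> range of3" by blast
  show ?thesis by (rule quintic_normal_form[OF b]) (rule that)
qed

text \<open>A normal form with \<open>n\<close> slices of order nine has \<open>n + 1\<close> points of weight 2 and none of higher weight,
  and \<open>121 - 3 (n + 1) = 118 - 3 n\<close>. Either quintic may turn up as the one with a root at hand, which is why
  the examples were given for both.\<close>

lemma size_from_weight_2:
  assumes "n \<in> {1,2,3,4,5,6,7,9}"
  obtains U where "subgrp (U :: ('a ^ 2) set)" "card U = 3 ^ 5" "card (L U) = 118 - 3 * n"
proof -
  obtain a :: 'a and p where a: "a \<notin> range of3" and p: "p \<in> set quintics" "a ^ 5 = ev a p"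
    by (rule quintic_element_exists)
  obtain c b g where cbg: "c \<in> set thirds" "b \<in> set betas" "g \<in> set (gammas c)" "(b, g) \<noteq> 0"
    and n: "rank1_count p c b g = n" by (rule rank1_count_attained[OF p(1) assms])
  define Y where "Y = normal_set a (ev a (lift c)) (ev a (lift b)) (ev a (lift g))"
  have c0: "c \<noteq> 0" using thirds_nonzero cbg(1) by blast
  obtain U v0 v1 where U: "subgrp U" "card U = 3 ^ 5" and v: "v0 \<noteq> 0" "v1 \<notin> proj_point v0"
    and Y: "lin v0 v1 -` U = Y"
    by (rule realise_coordinates[of Y]) (use subgrp_normal_set card_normal_set[OF a c0] in \<open>auto simp: Y_def\<close>)
  have inf: "card (slice_inf Y) = 9" unfolding Y_def by (rule card_slice_inf_normal_set[OF a c0])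
  have le2: "weight \<phi> U P \<le> 2" if "P \<in> L U" for P
  proof -
    have "(3::nat) ^ weight \<phi> U P < 3 ^ 3"
    proof (cases rule: point_slices[OF U(1) v that, unfolded Y])
      case 1
      then show ?thesis using inf by simp
    next
      case (2 m)
      then show ?thesis using card_slice_normal_set_less_27[OF a p(2) cbg] by (simp add: Y_def del: ev.simps)
    qed
    then have "weight \<phi> U P < 3" by (metis nat_power_less_imp_less zero_less_numeral)
    then show ?thesis by simp
  qed
  have "proj_point v0 \<in> points_of_weight \<phi> U 2"
    by (rule mem_points_of_weight[OF U(1)]) (use card_Int_base_point[OF v, of U] inf Y in auto)
  moreover have "card (points_of_weight \<phi> U 2 - {proj_point v0}) = n"
    using card_points_off_base[OF U(1) v, of 2] card_slices_normal_set[OF a p(2) c0, of b g] n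
    unfolding Y by (simp add: Y_def del: ev.simps)
  moreover have "finite (points_of_weight \<phi> U 2)" by (simp add: points_of_weight_def)
  ultimately have n2: "card (points_of_weight \<phi> U 2) = Suc n" by (metis card.remove)
  have "points_of_weight \<phi> U 3 = {}" "points_of_weight \<phi> U 4 = {}"
    using le2 unfolding points_of_weight_def by fastforce+
  moreover have "\<forall>P \<in> L U. weight \<phi> U P \<le> 4" using le2 by fastforce
  note weight_equations[OF U this]
  ultimately have "card (L U) = 118 - 3 * n" using n2 by simp
  then show ?thesis using that U by blast
qed

text \<open>The pairs \<open>(x, t)\<close> with \<open>t \<in> GF(3)\<close> and \<open>x\<close> in a group of order 81 define a 4-club.\<close>

lemma size_82:
  obtains U where "subgrp (U :: ('a ^ 2) set)" "card U = 3 ^ 5" "card (L U) = 82"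
proof -
  obtain a :: 'a and p where a: "a \<notin> range of3" and p: "p \<in> set quintics" "a ^ 5 = ev a p"
    by (rule quintic_element_exists)
  define f where "f = (\<lambda>(x0,x1,x2,x3,t). (ev a (x0,x1,x2,x3,0), of3 t :: 'a))"
  define Y where "Y = range f"
  have "subgrp Y" unfolding Y_def by (rule subgrp_range) (auto simp: f_def algebra_simps)
  moreover have "inj f"
    unfolding f_def by (rule injI) (auto simp: ev_inject[OF a] simp del: ev.simps)
  then have "card Y = 3 ^ 5" unfolding Y_def by (simp add: card_image card_gf3)
  ultimately obtain U v0 v1 where U: "subgrp U" "card U = 3 ^ 5" and v: "v0 \<noteq> 0" "v1 \<notin> proj_point v0"
    and Y: "lin v0 v1 -` U = Y"
    by (rule realise_coordinates)
  have "slice_inf Y = range (\<lambda>(x0,x1,x2,x3). ev a (x0,x1,x2,x3,0))" (is "_ = range ?h")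
    unfolding slice_inf_def Y_def f_def
    by (auto simp: image_iff simp del: ev.simps) (intro exI, rule refl)
  moreover have "inj ?h" by (rule injI) (auto simp: ev_inject[OF a] simp del: ev.simps)
  ultimately have "card (slice_inf Y) = 3 ^ 4" by (simp add: card_image card_gf3)
  then have "proj_point v0 \<in> points_of_weight \<phi> U 4"
    by (intro mem_points_of_weight[OF U(1)]) (use card_Int_base_point[OF v, of U] Y in auto)
  then have P0: "proj_point v0 \<in> L U" "card (points_of_weight \<phi> U 4) \<noteq> 0"
    by (auto simp: points_of_weight_def card_eq_0_iff)
  have "f (0,0,0,0,1) = (0, 1)" by (simp add: f_def)
  then have "(0, 1) \<in> lin v0 v1 -` U" unfolding Y Y_def by (metis rangeI)
  then have "v1 \<in> U" by (simp add: lin_def)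
  moreover have "v1 \<noteq> 0" using v(2) subgrpD(1)[OF subgrp_proj_point] by blast
  ultimately have "{proj_point v0, proj_point v1} \<subseteq> L U" using P0(1) mem_L by auto
  then have "card {proj_point v0, proj_point v1} \<le> card (L U)" by (intro card_mono) auto
  moreover have "proj_point v0 \<noteq> proj_point v1" using v(2) self_mem_proj_point by blast
  ultimately have "1 < card (L U)" by simp
  from U this have "card (L U) = 82"
    by (cases rule: weight_cases) (use P0(2) in auto)
  then show ?thesis using that U by blast
qed

text \<open>For the pairs \<open>(x ^ 3, x)\<close> the slice at \<open>m\<close> consists of 0 and the square roots of \<open>m\<close>, so every point has
  weight 1.\<close>

lemma size_121:
  obtains U where "subgrp (U :: ('a ^ 2) set)" "card U = 3 ^ 5" "card (L U) = 121"
proof -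
  define f where "f = (\<lambda>x :: 'a. (x ^ 3, x))"
  define Y where "Y = range f"
  have cube: "(x + y) ^ 3 = x ^ 3 + y ^ 3" for x y :: 'a
  proof -
    have "(x + y) ^ 3 = x ^ 3 + y ^ 3 + 3 * (x\<^sup>2 * y + x * y\<^sup>2)"
      by (simp add: power3_eq_cube power2_eq_square algebra_simps)
    then show ?thesis by (simp add: three)
  qed
  have "subgrp Y" unfolding Y_def by (rule subgrp_range) (simp add: f_def cube)
  moreover have "inj f" by (simp add: f_def inj_def)
  then have "card Y = 3 ^ 5" unfolding Y_def by (simp add: card_image card_field)
  ultimately obtain U v0 v1 where U: "subgrp U" "card U = 3 ^ 5" and v: "v0 \<noteq> 0" "v1 \<notin> proj_point v0"
    and Y: "lin v0 v1 -` U = Y"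
    by (rule realise_coordinates)
  have le1: "weight \<phi> U P \<le> 1" if "P \<in> L U" for P
  proof -
    have "(3::nat) ^ weight \<phi> U P \<le> 3 ^ 1"
    proof (cases rule: point_slices[OF U(1) v that, unfolded Y])
      case 1
      have "slice_inf Y = {0}" unfolding slice_inf_def Y_def f_def by auto
      then show ?thesis using 1 by simp
    next
      case (2 m)
      obtain z where z: "slice Y m \<subseteq> {0, z, - z}"
      proof (cases "\<exists>z. z\<^sup>2 = m")
        case True
        then obtain z where "z\<^sup>2 = m" by blast
        have "slice Y m \<subseteq> {0, z, - z}"
        proof
          fix y assume "y \<in> slice Y m"
          then have "z\<^sup>2 * y = y\<^sup>2 * y" unfolding slice_def Y_def f_def \<open>z\<^sup>2 = m\<close>
            by (auto simp: power3_eq_cube power2_eq_square)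
          then show "y \<in> {0, z, - z}" by (auto simp: power2_eq_iff)
        qed
        then show ?thesis by (rule that)
      next
        case False
        have "slice Y m \<subseteq> {0, 0, - 0}"
        proof
          fix y assume "y \<in> slice Y m"
          then have "m * y = y\<^sup>2 * y" unfolding slice_def Y_def f_def
            by (auto simp: power3_eq_cube power2_eq_square)
          then show "y \<in> {0, 0, - 0}" using False by auto
        qed
        then show ?thesis by (rule that)
      qed
      have "card (slice Y m) \<le> card {0, z, - z}" using z by (intro card_mono) auto
      also have "\<dots> \<le> 3" by (auto simp: card_insert_if)
      finally show ?thesis using 2 by simp
    qed
    then show ?thesis by (simp only: power_increasing_iff one_less_numeral_iff semiring_norm)
  qed
  have "points_of_weight \<phi> U 2 = {}" "points_of_weight \<phi> U 3 = {}" "points_of_weight \<phi> U 4 = {}"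
    using le1 unfolding points_of_weight_def by fastforce+
  moreover have "\<forall>P \<in> L U. weight \<phi> U P \<le> 4" using le1 by fastforce
  note weight_equations[OF U this]
  ultimately have "card (L U) = 121" by simp
  then show ?thesis using that U by blast
qed

lemma linear_set_5_iff: "linear_set \<phi> 5 S \<longleftrightarrow> (\<exists>U. subgrp U \<and> card U = 3 ^ 5 \<and> S = L U)"
proof -
  have "small_dim \<phi> U = 5 \<longleftrightarrow> card U = 3 ^ 5" if "subgrp U" for U
    unfolding card_subspace[OF that] by (rule power_inject_exp[symmetric]) simp
  then show ?thesis unfolding linear_set_def small_subspace_iff by blast
qed

lemma sizes: "{card S | S. linear_set \<phi> 5 S \<and> card S > 1} = {82, 91, 97, 100, 103, 106, 109, 112, 115, 121}"
proof (intro equalityI subsetI)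
  fix k assume "k \<in> {card S | S. linear_set \<phi> 5 S \<and> card S > 1}"
  then obtain S where "linear_set \<phi> 5 S" "1 < card S" "k = card S" by blast
  then obtain U :: "('a ^ 2) set" where U: "subgrp U" "card U = 3 ^ 5" "1 < card (L U)" and k: "k = card (L U)"
    unfolding linear_set_5_iff by blast
  show "k \<in> {82, 91, 97, 100, 103, 106, 109, 112, 115, 121}"
    using weight_distribution[OF U] unfolding k by (elim disjE conjE) auto
next
  have mem: "k \<in> {card S | S. linear_set \<phi> 5 S \<and> card S > 1}"
    if "subgrp U" "card U = 3 ^ 5" "card (L U) = k" "1 < k" for k and U :: "('a ^ 2) set"
    using that linear_set_5_iff by blast
  fix k :: nat assume "k \<in> {82, 91, 97, 100, 103, 106, 109, 112, 115, 121}"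
  then consider "k = 82" | "k = 121" | n where "n \<in> {1,2,3,4,5,6,7,9}" "k = 118 - 3 * n"
    by force
  then show "k \<in> {card S | S. linear_set \<phi> 5 S \<and> card S > 1}"
  proof cases
    case 1
    obtain U where "subgrp (U :: ('a ^ 2) set)" "card U = 3 ^ 5" "card (L U) = 82" by (rule size_82)
    then show ?thesis unfolding 1 by (rule mem) simp
  next
    case 2
    obtain U where "subgrp (U :: ('a ^ 2) set)" "card U = 3 ^ 5" "card (L U) = 121" by (rule size_121)
    then show ?thesis unfolding 2 by (rule mem) simp
  next
    case (3 n)
    obtain U where "subgrp (U :: ('a ^ 2) set)" "card U = 3 ^ 5" "card (L U) = 118 - 3 * n"
      by (rule size_from_weight_2[OF 3(1)])
    then show ?thesis unfolding 3(2) by (rule mem) (use 3(1) in auto)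
  qed
qed

end

theorem theorem1p3:
  fixes \<phi> :: "'k::field \<Rightarrow> 'a::field"
  assumes "field_embedding \<phi>"
    and "CARD('k) = 3"
    and "CARD('a) = 3 ^ 5"
  shows "(\<forall>S U. small_subspace \<phi> U \<and> small_dim \<phi> U = 5 \<and> S = L U \<and> card S > 1 \<longrightarrow>
            (card (points_of_weight \<phi> U 4) = 1 \<and> card (points_of_weight \<phi> U 1) = 81 \<and>
               (\<forall>P \<in> S. weight \<phi> U P \<in> {4, 1}) \<and> club \<phi> 4 U)
          \<or> (card (points_of_weight \<phi> U 3) = 1 \<and> card (points_of_weight \<phi> U 2) \<in> {0, 3, 9} \<and>
               (\<forall>P \<in> S. weight \<phi> U P \<in> {3, 2, 1}))
          \<or> (card (points_of_weight \<phi> U 2) \<in> {2, 3, 4, 5, 6, 7, 8, 10} \<and>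
               (\<forall>P \<in> S. weight \<phi> U P \<in> {2, 1}))
          \<or> (card (points_of_weight \<phi> U 1) = 121 \<and>
               (\<forall>P \<in> S. weight \<phi> U P = 1) \<and> scattered \<phi> 5 S))
       \<and> {card S | S. linear_set \<phi> 5 S \<and> card S > 1}
           = {82, 91, 97, 100, 103, 106, 109, 112, 115, 121}"
proof -
  interpret ternary_plane \<phi>
    by (intro ternary_plane.intro gf243.intro ternary_plane_axioms.intro assms)
  show ?thesis
  proof (intro conjI allI impI)
    fix S U
    assume "small_subspace \<phi> U \<and> small_dim \<phi> U = 5 \<and> S = L U \<and> card S > 1"
    then have U: "subgrp U" "card U = 3 ^ 5" "1 < card (L U)" and S: "S = L U"
      and lin: "linear_set \<phi> 5 S"
      using card_subspace[of U] unfolding small_subspace_iff linear_set_def by auto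
    have "scattered \<phi> 5 S" if "card (L U) = 121"
      using that lin S assms(2) by (simp add: scattered_def)
    then show "(card (points_of_weight \<phi> U 4) = 1 \<and> card (points_of_weight \<phi> U 1) = 81 \<and>
               (\<forall>P \<in> S. weight \<phi> U P \<in> {4, 1}) \<and> club \<phi> 4 U)
          \<or> (card (points_of_weight \<phi> U 3) = 1 \<and> card (points_of_weight \<phi> U 2) \<in> {0, 3, 9} \<and>
               (\<forall>P \<in> S. weight \<phi> U P \<in> {3, 2, 1}))
          \<or> (card (points_of_weight \<phi> U 2) \<in> {2, 3, 4, 5, 6, 7, 8, 10} \<and>
               (\<forall>P \<in> S. weight \<phi> U P \<in> {2, 1}))
          \<or> (card (points_of_weight \<phi> U 1) = 121 \<and>
               (\<forall>P \<in> S. weight \<phi> U P = 1) \<and> scattered \<phi> 5 S)"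
      using weight_distribution[OF U] unfolding S by argo
  qed (rule sizes)
qed

end
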